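(* Let $p\ge1$, let $A$ be an analytic vector field on $\mathbb C^p$, and let $O^p\subset\mathbb C^p$ be an open set with compact closure. Then there exists a neighbourhood $O\subset\mathbb C$ of $0$ such that for all $t\in O$ and all $x=(x^1,\dots,x^p)\in O^p$ one has $m(A_x)\,|t|<1$, and the functions $$y_{i,x}(t)=\epsilon_F\big(e^{x\cdot d}\circ e^{tD_A}(f_{i(1)}^o)\big),\qquad 1\le i\le p,$$ satisfy, for all $i\in\{1,\dots,p\}$, $t\in O$, $x\in O^p$, $$\frac{d}{dt}y_{i,x}(t)=A^i\big(y_{1,x}(t),y_{2,x}(t),\dots,y_{p,x}(t)\big)\qquad\text{and}\qquad y_{i,x}(0)=x^i.$$
   Context: Work over $\mathbb C$. Let $o=(0,\dots,0)\in\mathbb N^p$, and for $1\le i\le p$ let $i(1)\in\mathbb N^p$ be the multi-index with $1$ in position $i$ and $0$ elsewhere. The elements $f_n^o$, $n\in\mathbb N^p$, form the zeroth row of the basis $(f_n^m)_{n,m\in\mathbb N^p}$ of the approximated coalgebra $F_a$, whose counit is $\epsilon_F(f_n^m)=1$ if $n=m$ and $0$ otherwise. An analytic vector field $A$ on $\mathbb C^p$ has components $A^i(z)=\sum_{m\in\mathbb N^p}a_m^iz_1^{m_1}\cdots z_p^{m_p}$, $1\le i\le p$, analytic on all of $\mathbb C^p$; put $m(A)=\sup_{1\le i\le p}\sum_{m\in\mathbb N^p}|a_m^i|$. The associated derivation acts on the elements $f_n^o$ by $$D_A(f_n^o)=\sum_{i=1}^p n_i\sum_{m\in\mathbb N^p}a_m^i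 f_{n+m-i(1)}^o$$ (terms with $n_i=0$ read as $0$), extended term by term to formal series $\sum_n c_nf_n^o$ (each coefficient of the result is a finite sum), and $\epsilon_F(\sum_nc_nf_n^o)=c_o$. For $1\le i\le p$ let $d_i(f_n^o)=n_if_{n-i(1)}^o$; the $d_i$ commute, and for $x\in\mathbb C^p$, $e^{x\cdot d}=e^{x^1d_1}\circ\cdots\circ e^{x^pd_p}$ (written $e^{x^i.d_i}$ in the paper), extended term by term to series $\sum_nc_nf_n^o$ for which $\sum_n c_nz^n$ converges on all of $\mathbb C^p$. The expression defining $y_{i,x}(t)$ means $$y_{i,x}(t)=\sum_{n\in\mathbb N}\frac{t^n}{n!}\,\epsilon_F\big(e^{x\cdot d}\circ D_A^n(f_{i(1)}^o)\big).$$ $A_x$ is the vector field defined by $D_{A_x}=e^{x\cdot d}\circ D_A\circ e^{-x\cdot d}$, i.e. the vector field with components $A_x^i(z)=A^i(x+z)$; thus $m(A_x)$ is the supremum over $i$ of the sum of the absolute values of the Taylor coefficients of $A^i$ at $x$. *)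

theory Defs
  imports "HOL-Analysis.Analysis"
begin

text \<open>
  The index set \<open>{1,\<dots>,p}\<close> is a finite type \<open>'p\<close>, so that multi-indices are vectors of type
  \<open>nat ^ 'p\<close>; \<open>axis i 1\<close> is the multi-index written \<open>i(1)\<close>.
\<close>

definition mpow :: "complex ^ 'p::finite \<Rightarrow> nat ^ 'p \<Rightarrow> complex" where
  "mpow z n = (\<Prod>i\<in>UNIV. (z $ i) ^ (n $ i))"

subsection \<open>Analytic vector fields\<close>

definition has_vf_coeffs ::
    "(complex ^ 'p::finite \<Rightarrow> complex ^ 'p) \<Rightarrow> ('p \<Rightarrow> nat ^ 'p \<Rightarrow> complex) \<Rightarrow> bool" where
  "has_vf_coeffs A a \<longleftrightarrow> (\<forall>i z. ((\<lambda>m. a i m * mpow z m) has_sum A z $ i) UNIV)"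

definition analytic_vf :: "(complex ^ 'p::finite \<Rightarrow> complex ^ 'p) \<Rightarrow> bool" where
  "analytic_vf A \<longleftrightarrow> (\<exists>a. has_vf_coeffs A a)"

text \<open>The coefficients of an everywhere convergent power series are unique, so the choice
  operator selects the Taylor coefficients at the origin.\<close>

definition vf_coeff :: "(complex ^ 'p::finite \<Rightarrow> complex ^ 'p) \<Rightarrow> 'p \<Rightarrow> nat ^ 'p \<Rightarrow> complex" where
  "vf_coeff A = (SOME a. has_vf_coeffs A a)"

definition vf_norm :: "(complex ^ 'p::finite \<Rightarrow> complex ^ 'p) \<Rightarrow> real" where
  "vf_norm A = (SUP i. \<Sum>\<^sub>\<infinity>m. norm (vf_coeff A i m))"

definition vf_shift ::
    "complex ^ 'p::finite \<Rightarrow> (complex ^ 'p \<Rightarrow> complex ^ 'p) \<Rightarrow> complex ^ 'p \<Rightarrow> complex ^ 'p" where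
  "vf_shift x A = (\<lambda>z. A (x + z))"

subsection \<open>Formal series in the zeroth row of the basis\<close>

text \<open>A formal series \<open>\<Sum>\<^sub>n c\<^sub>n f\<^sub>n\<^sup>o\<close> is represented by its coefficient family \<open>c\<close>.\<close>

type_synonym 'p row_series = "nat ^ 'p \<Rightarrow> complex"

definition row_basis :: "nat ^ 'p::finite \<Rightarrow> 'p row_series" where
  "row_basis n = (\<lambda>k. if k = n then 1 else 0)"

definition counit :: "'p::finite row_series \<Rightarrow> complex" where
  "counit c = c 0"

text \<open>The coefficient of \<open>f\<^sub>k\<^sup>o\<close> in \<open>D\<^sub>A(\<Sum>\<^sub>n c\<^sub>n f\<^sub>n\<^sup>o)\<close> collects the finitely many terms with
  \<open>n + m - i(1) = k\<close>; the condition is written without truncated subtraction, which only matters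
  for the terms with \<open>n\<^sub>i = 0\<close>, and these vanish.\<close>

definition vf_deriv :: "(complex ^ 'p::finite \<Rightarrow> complex ^ 'p) \<Rightarrow> 'p row_series \<Rightarrow> 'p row_series" where
  "vf_deriv A c = (\<lambda>k. \<Sum>i\<in>UNIV. \<Sum>(n, m) | n + m = k + axis i 1.
     c n * of_nat (n $ i) * vf_coeff A i m)"

definition row_d :: "'p::finite \<Rightarrow> 'p row_series \<Rightarrow> 'p row_series" where
  "row_d i c = (\<lambda>k. of_nat (k $ i + 1) * c (k + axis i 1))"

definition exp_d :: "'p::finite \<Rightarrow> complex \<Rightarrow> 'p row_series \<Rightarrow> 'p row_series" where
  "exp_d i s c = (\<lambda>k. \<Sum>j. s ^ j / fact j * (row_d i ^^ j) c k)"

definition exp_d_list :: "'p::finite list \<Rightarrow> complex ^ 'p \<Rightarrow> 'p row_series \<Rightarrow> 'p row_series" where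
  "exp_d_list is x = foldr (\<lambda>i. exp_d i (x $ i)) is"

definition index_list :: "'p::finite list" where
  "index_list = (SOME is. distinct is \<and> set is = UNIV)"

text \<open>\<open>e\<^bsup>x\<cdot>d\<^esup>\<close> is the composition of the \<open>e\<^bsup>x\<^sup>id\<^sub>i\<^esup>\<close> on basis elements, extended term by term. Any
  enumeration of the indices gives the same result (\<open>exp_d_list_basis\<close>), and the infinite sum
  converges for everywhere convergent series (\<open>exp_xd_summable\<close>), a class containing all
  \<open>D\<^sub>A\<^sup>n f\<^bsub>i(1)\<^esub>\<^sup>o\<close> (\<open>entire_series_vf_deriv\<close>).\<close>

definition exp_xd :: "complex ^ 'p::finite \<Rightarrow> 'p row_series \<Rightarrow> 'p row_series" where
  "exp_xd x c = (\<lambda>k. \<Sum>\<^sub>\<infinity>n. c n * exp_d_list index_list x (row_basis n) k)"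

text \<open>The terms and the sum of the series in \<open>t\<close> defining \<open>y\<^sub>i\<^sub>,\<^sub>x(t) = \<epsilon>\<^sub>F(e\<^bsup>x\<cdot>d\<^esup> \<circ> e\<^bsup>tD\<^sub>A\<^esup>(f\<^bsub>i(1)\<^esub>\<^sup>o))\<close>.\<close>

definition y_term ::
    "(complex ^ 'p::finite \<Rightarrow> complex ^ 'p) \<Rightarrow> 'p \<Rightarrow> complex ^ 'p \<Rightarrow> nat \<Rightarrow> complex \<Rightarrow> complex" where
  "y_term A i x n t =
     t ^ n / fact n * counit (exp_xd x ((vf_deriv A ^^ n) (row_basis (axis i 1))))"

definition y_fun ::
    "(complex ^ 'p::finite \<Rightarrow> complex ^ 'p) \<Rightarrow> 'p \<Rightarrow> complex ^ 'p \<Rightarrow> complex \<Rightarrow> complex" where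
  "y_fun A i x t = (\<Sum>n. y_term A i x n t)"

subsection \<open>The operators are well defined\<close>

lemma funpow_row_d:
  fixes k :: "nat ^ 'p::finite"
  shows "(row_d i ^^ j) c k = of_nat (\<Prod>l<j. k $ i + l + 1) * c (k + axis i j)"
proof (induction j arbitrary: k)
  case 0
  have "k + axis i 0 = k" by (simp add: vec_eq_iff axis_def)
  then show ?case by (simp del: axis_eq_0_iff)
next
  case (Suc j)
  have "k + axis i 1 + axis i j = k + axis i (Suc j)"
    by (simp add: vec_eq_iff axis_def)
  moreover have "(\<Prod>l<Suc j. k $ i + l + 1) = (k $ i + 1) * (\<Prod>l<j. (k + axis i 1) $ i + l + 1)"
    by (subst prod.lessThan_Suc_shift) (simp add: axis_def ac_simps)
  moreover have "(row_d i ^^ Suc j) c k = of_nat (k $ i + 1) * (row_d i ^^ j) c (k + axis i 1)"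
    by (simp add: row_d_def)
  ultimately show ?case
    by (simp only: Suc.IH of_nat_mult mult.assoc)
qed

lemma prod_rising_fact: "(\<Prod>l<j. k + l + 1) * fact k = (fact (k + j) :: nat)"
  by (induction j) (auto simp: algebra_simps)

lemma exp_d_list_basis:
  fixes n k :: "nat ^ 'p::finite"
  assumes "distinct is"
  shows "exp_d_list is x (row_basis n) k =
    (\<Prod>i\<in>UNIV. if i \<in> set is then of_nat (n $ i choose (k $ i)) * (x $ i) ^ (n $ i - k $ i)
       else if k $ i = n $ i then 1 else 0)"
  using assms
proof (induction "is" arbitrary: k)
  case Nil
  have "(\<Prod>i\<in>UNIV. if k $ i = n $ i then 1 else 0 :: complex) = (if k = n then 1 else 0)"
    by (auto simp: vec_eq_iff)
  then show ?case by (simp add: exp_d_list_def row_basis_def)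
next
  case (Cons i "is")
  define F where "F js k l = (if l \<in> set js
      then of_nat (n $ l choose (k $ l)) * (x $ l) ^ (n $ l - k $ l)
      else if k $ l = n $ l then 1 else 0 :: complex)" for js k l
  define R where "R = (\<Prod>l\<in>UNIV - {i}. F is k l)"
  have IH: "exp_d_list is x (row_basis n) k' = (\<Prod>l\<in>UNIV. F is k' l)" for k'
    using Cons unfolding F_def by simp
  have split: "(\<Prod>l\<in>UNIV. G l) = G i * (\<Prod>l\<in>UNIV - {i}. G l)" for G :: "'p \<Rightarrow> complex"
    by (rule prod.remove) auto
  have step: "exp_d_list is x (row_basis n) (k + axis i j) =
      (if k $ i + j = n $ i then R else 0)" for j
  proof -
    have "(\<Prod>l\<in>UNIV - {i}. F is (k + axis i j) l) = R"
      unfolding R_def F_def by (rule prod.cong) (auto simp: axis_def)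
    moreover have "F is (k + axis i j) i = (if k $ i + j = n $ i then 1 else 0)"
      using Cons.prems by (simp add: F_def axis_def)
    ultimately show ?thesis by (simp add: IH split)
  qed
  have R': "(\<Prod>l\<in>UNIV - {i}. F (i # is) k l) = R"
    unfolding R_def F_def by (rule prod.cong) auto
  have "exp_d_list (i # is) x (row_basis n) k =
      (\<Sum>j. (x $ i) ^ j / fact j * (of_nat (\<Prod>l<j. k $ i + l + 1) * (if k $ i + j = n $ i then R else 0)))"
    by (simp add: exp_d_list_def exp_d_def funpow_row_d step[unfolded exp_d_list_def]
             del: of_nat_prod of_nat_add)
  also have "\<dots> = (\<Sum>j\<in>{n $ i - k $ i}. (x $ i) ^ j / fact j * (of_nat (\<Prod>l<j. k $ i + l + 1) * (if k $ i + j = n $ i then R else 0)))"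
    by (rule suminf_finite) auto
  also have "\<dots> = F (i # is) k i * R"
  proof (cases "k $ i \<le> n $ i")
    case True
    define j where "j = n $ i - k $ i"
    have n: "n $ i = k $ i + j" using True by (simp add: j_def)
    have "(\<Prod>l<j. k $ i + l + 1) * fact (k $ i) = (n $ i choose (k $ i)) * fact j * (fact (k $ i) :: nat)"
      unfolding prod_rising_fact n[symmetric] using binomial_fact_lemma[OF True]
      by (simp add: j_def mult_ac)
    then have "(\<Prod>l<j. k $ i + l + 1) = (n $ i choose (k $ i)) * fact j"
      by (simp only: mult_cancel2 fact_nonzero simp_thms)
    then have "of_nat (\<Prod>l<j. k $ i + l + 1) = (of_nat (n $ i choose (k $ i)) * fact j :: complex)"
      by (metis of_nat_mult of_nat_fact)
    then show ?thesis using True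
      by (simp add: F_def j_def[symmetric] n[symmetric] del: of_nat_prod of_nat_add)
  next
    case False
    then show ?thesis by (simp add: F_def)
  qed
  also have "\<dots> = (\<Prod>l\<in>UNIV. F (i # is) k l)"
    by (simp add: split R')
  finally show ?case by (simp add: F_def)
qed

lemma index_list: "distinct (index_list :: 'p::finite list)" "set (index_list :: 'p list) = UNIV"
proof -
  have "\<exists>is :: 'p list. distinct is \<and> set is = UNIV"
    using finite_distinct_list[OF finite_class.finite_UNIV] by blast
  from someI_ex[OF this]
  show "distinct (index_list :: 'p list)" "set (index_list :: 'p list) = UNIV"
    by (simp_all add: index_list_def)
qed

definition entire_series :: "'p::finite row_series \<Rightarrow> bool" where
  "entire_series c \<longleftrightarrow> (\<forall>z. (\<lambda>n. c n * mpow z n) summable_on UNIV)"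

lemma entire_series_row_basis: "entire_series (row_basis n)"
proof -
  have "(\<lambda>m. row_basis n m * mpow z m) summable_on UNIV \<longleftrightarrow>
      (\<lambda>m. row_basis n m * mpow z m) summable_on {n}" for z
    by (rule summable_on_cong_neutral) (auto simp: row_basis_def)
  then show ?thesis by (simp add: entire_series_def)
qed

lemma norm_mpow: "norm (mpow z n) = (\<Prod>i\<in>UNIV. norm (z $ i) ^ (n $ i))"
  by (simp add: mpow_def prod_norm[symmetric] norm_power)

lemma entire_series_dominated:
  assumes "entire_series c" and "\<And>n. norm (b n) \<le> norm (mpow w n)"
  shows "(\<lambda>n. norm (c n * b n)) summable_on UNIV"
proof (rule summable_on_comparison_test)
  show "(\<lambda>n. norm (c n * mpow w n)) summable_on UNIV"
    using assms(1) unfolding entire_series_def summable_on_iff_abs_summable_on_complex by blast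
qed (auto simp: norm_mult assms(2) intro!: mult_left_mono)

lemma exp_xd_summable:
  fixes x :: "complex ^ 'p::finite"
  assumes "entire_series c"
  shows "(\<lambda>n. c n * exp_d_list index_list x (row_basis n) k) summable_on UNIV"
proof -
  define w :: "complex ^ 'p" where "w = (\<chi> i. of_real (2 * max 1 (norm (x $ i))))"
  have "norm (exp_d_list index_list x (row_basis n) k) \<le> norm (mpow w n)" for n
    unfolding exp_d_list_basis[OF index_list(1)] norm_mpow prod_norm[symmetric]
  proof (rule prod_mono, intro conjI)
    fix i
    have "real (n $ i choose (k $ i)) * norm (x $ i) ^ (n $ i - k $ i)
        \<le> 2 ^ (n $ i) * max 1 (norm (x $ i)) ^ (n $ i)"
    proof (rule mult_mono)
      show "real (n $ i choose (k $ i)) \<le> 2 ^ (n $ i)"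
        using binomial_le_pow2[of "n $ i" "k $ i"]
        by (metis of_nat_le_iff of_nat_numeral of_nat_power)
      have "norm (x $ i) ^ (n $ i - k $ i) \<le> max 1 (norm (x $ i)) ^ (n $ i - k $ i)"
        by (rule power_mono) auto
      also have "\<dots> \<le> max 1 (norm (x $ i)) ^ (n $ i)"
        by (rule power_increasing) auto
      finally show "norm (x $ i) ^ (n $ i - k $ i) \<le> max 1 (norm (x $ i)) ^ (n $ i)" .
    qed auto
    then show "norm (if i \<in> set index_list
        then of_nat (n $ i choose (k $ i)) * (x $ i) ^ (n $ i - k $ i)
        else if k $ i = n $ i then 1 else 0 :: complex) \<le> norm (w $ i) ^ (n $ i)"
      by (simp add: index_list(2) w_def norm_mult norm_power power_mult_distrib)
  qed auto
  from entire_series_dominated[OF assms this] show ?thesis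
    by (simp add: summable_on_iff_abs_summable_on_complex)
qed

lemma finite_vec_sum_eq: "finite {(n, m). n + m = (k :: nat ^ 'p::finite)}"
proof -
  define B where "B = vec_lambda ` PiE UNIV (\<lambda>i. {..k $ i})"
  have B: "finite B" unfolding B_def by (intro finite_imageI finite_PiE) auto
  have "n \<in> B" if "\<And>i. n $ i \<le> k $ i" for n
    using that by (auto simp: B_def PiE_def Pi_def intro!: image_eqI[of _ _ "vec_nth n"])
  then have "{(n, m). n + m = k} \<subseteq> B \<times> B" by auto
  then show ?thesis using finite_subset B by blast
qed

lemma summable_on_Cauchy_product:
  fixes c a :: "'p::finite row_series"
  assumes "entire_series c" and "entire_series a"
  shows "(\<lambda>k. (\<Sum>(n, m) | n + m = k + axis i 1. c n * of_nat (n $ i) * a m) * mpow z k) summable_on UNIV"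
proof -
  define w :: "complex ^ 'p" where "w = (\<chi> l. of_real (2 * max 1 (norm (z $ l))))"
  define P where "P k = {(n, m). n + m = k + axis i (1 :: nat)}" for k :: "nat ^ 'p"
  define f where "f = (\<lambda>(k, n, m). c n * of_nat (n $ i) * a m * mpow z k)"
  define g where "g = (\<lambda>(n, m). (c n * mpow w n) * (a m * mpow w m))"
  have abs: "(\<lambda>n. norm (c n * mpow w n)) summable_on UNIV" "(\<lambda>n. norm (a n * mpow w n)) summable_on UNIV"
    using assms unfolding entire_series_def summable_on_iff_abs_summable_on_complex by blast+
  have "(\<lambda>q. norm (g q)) summable_on UNIV \<times> UNIV"
    unfolding Infinite_Sum.abs_summable_on_Sigma_iff g_def prod.case norm_mult[of "c _ * mpow w _"]
    using abs
    by (simp add: abs_mult infsum_nonneg infsum_cmult_right' summable_on_cmult_right summable_on_cmult_left)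
  then have "(\<lambda>q. norm (g q)) summable_on snd ` Sigma UNIV P"
    by (rule summable_on_subset_banach) auto
  moreover have "inj_on snd (Sigma UNIV P)"
    by (auto simp: inj_on_def P_def)
  ultimately have g: "(\<lambda>q. norm (g (snd q))) summable_on Sigma UNIV P"
    by (simp add: summable_on_reindex o_def)
  have le: "of_nat (n $ i) * norm (mpow z k) \<le> norm (mpow w n) * norm (mpow w m)"
    if "n + m = k + axis i 1" for n m k
  proof -
    define M where "M l = max 1 (norm (z $ l))" for l
    have k: "k $ l \<le> n $ l + m $ l" for l
      using arg_cong[OF that, of "\<lambda>v. v $ l"] by simp
    have M: "1 \<le> M l" "norm (z $ l) \<le> M l" for l by (auto simp: M_def)
    have "real (n $ i) \<le> 2 ^ (n $ i)" by (rule less_imp_le, rule of_nat_less_two_power)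
    also have "\<dots> \<le> (\<Prod>l\<in>UNIV. 2 ^ (n $ l))"
      by (subst prod.remove[of _ i]) (auto intro!: prod_ge_1)
    finally have 1: "real (n $ i) \<le> (\<Prod>l\<in>UNIV. 2 ^ (n $ l))" .
    have "norm (z $ l) ^ (k $ l) \<le> M l ^ (n $ l + m $ l)" for l
      using M[of l] k[of l] by (meson power_mono power_increasing norm_ge_zero order_trans)
    then have 2: "norm (mpow z k) \<le> (\<Prod>l\<in>UNIV. M l ^ (n $ l + m $ l))"
      unfolding norm_mpow by (intro prod_mono) auto
    have "of_nat (n $ i) * norm (mpow z k) \<le> (\<Prod>l\<in>UNIV. 2 ^ (n $ l)) * (\<Prod>l\<in>UNIV. M l ^ (n $ l + m $ l))"
      by (intro mult_mono 1 2 prod_nonneg) auto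
    also have "\<dots> \<le> norm (mpow w n) * norm (mpow w m)"
      unfolding norm_mpow prod.distrib[symmetric]
    proof (intro prod_mono conjI)
      fix l
      have "M l ^ (m $ l) \<le> (2 * M l) ^ (m $ l)"
        using M(1)[of l] by (intro power_mono) auto
      then have "2 ^ (n $ l) * M l ^ (n $ l) * M l ^ (m $ l) \<le> (2 * M l) ^ (n $ l) * (2 * M l) ^ (m $ l)"
        using M(1)[of l] unfolding power_mult_distrib[of 2 "M l" "n $ l", symmetric]
        by (intro mult_left_mono) auto
      moreover have "norm (w $ l) = 2 * M l" by (simp add: w_def M_def norm_mult)
      ultimately show "2 ^ (n $ l) * M l ^ (n $ l + m $ l) \<le> norm (w $ l) ^ (n $ l) * norm (w $ l) ^ (m $ l)"
        by (simp add: power_add mult.assoc)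
      show "0 \<le> 2 ^ (n $ l) * M l ^ (n $ l + m $ l)" using M(1)[of l] by auto
    qed
    finally show ?thesis .
  qed
  have "norm (f q) \<le> norm (g (snd q))" if "q \<in> Sigma UNIV P" for q
  proof -
    obtain k n m where q: "q = (k, n, m)" by (metis prod.exhaust)
    have "norm (f q) = (norm (c n) * norm (a m)) * (of_nat (n $ i) * norm (mpow z k))"
      by (simp add: q f_def norm_mult)
    also have "\<dots> \<le> (norm (c n) * norm (a m)) * (norm (mpow w n) * norm (mpow w m))"
      using that by (intro mult_left_mono le) (auto simp: q P_def)
    also have "\<dots> = norm (g (snd q))" by (simp add: q g_def norm_mult)
    finally show ?thesis .
  qed
  with g have "(\<lambda>q. norm (f q)) summable_on Sigma UNIV P"
    by (rule Infinite_Sum.abs_summable_on_comparison_test)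
  then have "f summable_on Sigma UNIV P" by (rule abs_summable_summable)
  moreover have fin: "finite (P k)" for k
    unfolding P_def by (rule finite_vec_sum_eq)
  ultimately have "(\<lambda>k. infsum (\<lambda>y. f (k, y)) (P k)) summable_on UNIV"
    by (intro summable_on_SigmaD) auto
  moreover have "infsum (\<lambda>y. f (k, y)) (P k)
      = (\<Sum>(n, m) | n + m = k + axis i 1. c n * of_nat (n $ i) * a m) * mpow z k" for k
    using fin[of k] by (simp add: P_def f_def sum_distrib_right case_prod_unfold)
  ultimately show ?thesis by simp
qed

lemma entire_series_vf_deriv:
  assumes "analytic_vf A" and "entire_series c"
  shows "entire_series (vf_deriv A c)"
proof -
  have "has_vf_coeffs A (vf_coeff A)"
    using assms(1) unfolding analytic_vf_def vf_coeff_def by (rule someI_ex)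
  then have "entire_series (vf_coeff A i)" for i
    unfolding has_vf_coeffs_def entire_series_def summable_on_def by blast
  note * = summable_on_Cauchy_product[OF assms(2) this]
  have "(\<lambda>k. \<Sum>i\<in>S. (\<Sum>(n, m) | n + m = k + axis i 1. c n * of_nat (n $ i) * vf_coeff A i m) * mpow z k)
      summable_on UNIV" if "finite S" for S z
    using that by (induction S) (auto intro!: summable_on_add *[simplified])
  then show ?thesis
    unfolding entire_series_def vf_deriv_def by (simp add: sum_distrib_right)
qed

end

theory Submission imports Defs begin

text \<open>
  Read a row series \<open>c\<close> as the power series \<open>z \<mapsto> \<Sum>\<^sub>n c\<^sub>n z\<^sup>n\<close>. Then \<open>\<epsilon>\<^sub>F \<circ> e\<^bsup>x\<cdot>d\<^esup>\<close> is evaluation at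
  \<open>x\<close> (\<open>counit_exp_xd\<close>), because \<open>e\<^bsup>x\<cdot>d\<^esup>\<close> is translation by \<open>x\<close>, and \<open>D\<^sub>A\<close> is the derivation
  \<open>\<Sum>\<^sub>i A\<^sup>i \<partial>\<^sub>i\<close> for the Cauchy product of series (\<open>vf_deriv_mult\<close>). So \<open>y\<^sub>i\<^sub>,\<^sub>x(t)\<close> is the Lie series
  \<open>L\<^sub>t(z\<^sub>i) = \<Sum>\<^sub>n (t\<^sup>n / n!) (D\<^sub>A\<^sup>n z\<^sub>i)(x)\<close>, and the theorem says that Lie series integrate the vector
  field.

  Convergence is a majorant argument. Put \<open>\<parallel>c\<parallel>\<^sub>r = \<Sum>\<^sub>n \<bar>c\<^sub>n\<bar> r\<^bsup>\<bar>n\<bar>\<^esup>\<close>. This norm is submultiplicative, and a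
  partial derivative costs a factor \<open>1/\<delta>\<close> when the radius shrinks by \<open>\<delta>\<close>. Distributing a total loss
  of radius \<open>1\<close> evenly over \<open>n\<close> applications of \<open>D\<^sub>A\<close> gives
  \<open>\<parallel>D\<^sub>A\<^sup>n c\<parallel>\<^sub>R \<le> (M n)\<^sup>n \<parallel>c\<parallel>\<^sub>R\<^sub>+\<^sub>1 \<le> n! (M e)\<^sup>n \<parallel>c\<parallel>\<^sub>R\<^sub>+\<^sub>1\<close> with \<open>M = \<Sum>\<^sub>i \<parallel>A\<^sup>i\<parallel>\<^sub>R\<^sub>+\<^sub>1\<close>
  (\<open>wbound_vf_deriv_fact\<close>). Hence for \<open>\<bar>t\<bar> M e < 1\<close> and all \<open>x\<close> in the polydisc of radius \<open>R\<close> the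
  functional \<open>L\<^sub>t\<close> is defined on every entire series and is bounded for \<open>\<parallel>\<cdot>\<parallel>\<^sub>R\<^sub>+\<^sub>1\<close>.

  By the Leibniz rule \<open>L\<^sub>t\<close> is multiplicative, so it sends the monomial \<open>z\<^sup>m\<close> to \<open>y(t)\<^sup>m\<close>; being
  linear and bounded it sends every entire series \<open>c\<close> to \<open>c(y(t))\<close> (\<open>lie_exp_eq_series_val\<close>).
  Differentiating in \<open>t\<close> term by term turns \<open>L\<^sub>t(c)\<close> into \<open>L\<^sub>t(D\<^sub>A c)\<close>. With \<open>c = z\<^sub>i\<close>, where
  \<open>D\<^sub>A z\<^sub>i = A\<^sup>i\<close>, the derivative of \<open>y\<^sub>i\<close> is \<open>L\<^sub>t(A\<^sup>i) = A\<^sup>i(y(t))\<close>.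

  For the bound on \<open>m(A\<^sub>x)\<close>, the Taylor coefficients of \<open>A\<^sup>i\<close> at \<open>x\<close> are those of \<open>e\<^bsup>x\<cdot>d\<^esup> A\<^sup>i\<close>
  (\<open>has_vf_coeffs_vf_shift\<close>, with the uniqueness statement \<open>vf_coeff_unique\<close>); by the
  binomial theorem the sum of their absolute values is at most \<open>\<parallel>A\<^sup>i\<parallel>\<^sub>R\<^sub>+\<^sub>1\<close> (\<open>wbound_exp_xd\<close>).
\<close>

section \<open>Cauchy products and derivations of row series\<close>

definition mdeg :: "nat ^ 'p::finite \<Rightarrow> nat" where
  "mdeg n = (\<Sum>i\<in>UNIV. n $ i)"

definition conv :: "'p::finite row_series \<Rightarrow> 'p row_series \<Rightarrow> 'p row_series" where
  "conv c d = (\<lambda>k. \<Sum>(n, m) | n + m = k. c n * d m)"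

lemma mdeg_add: "mdeg (n + m) = mdeg n + mdeg m"
  by (simp add: mdeg_def sum.distrib)

lemma mdeg_axis: "mdeg (axis i 1) = 1"
  by (simp add: mdeg_def axis_def)

lemma component_le_mdeg: "n $ i \<le> mdeg n"
  unfolding mdeg_def by (rule member_le_sum) auto

lemma mpow_add: "mpow z (n + m) = mpow z n * mpow z m"
  by (simp add: mpow_def power_add prod.distrib)

lemma mpow_0: "mpow z 0 = 1"
  by (simp add: mpow_def)

lemma mpow_axis: "mpow z (axis i 1) = z $ i"
proof -
  have "mpow z (axis i 1) = (\<Prod>l\<in>UNIV. if l = i then z $ l else 1)"
    unfolding mpow_def by (rule prod.cong) (auto simp: axis_def)
  then show ?thesis by simp
qed

lemma norm_mpow_le:
  assumes "\<And>i. norm (z $ i) \<le> R"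
  shows "norm (mpow z n) \<le> R ^ mdeg n"
proof -
  have "norm (mpow z n) \<le> (\<Prod>i\<in>UNIV. R ^ (n $ i))"
    unfolding norm_mpow using assms by (intro prod_mono) (auto intro!: power_mono)
  then show ?thesis by (simp add: mdeg_def power_sum)
qed

text \<open>
  The substitution \<open>n \<mapsto> n + i(1)\<close> misses only pairs with \<open>n\<^sub>i = 0\<close>, whose terms vanish. The right-hand
  side avoids truncated subtraction and matches the form in which \<open>D\<^sub>A\<close> is given.
\<close>

lemma conv_row_d_left:
  "conv (row_d i c) d k = (\<Sum>(n, m) | n + m = k + axis i 1. c n * of_nat (n $ i) * d m)"
proof -
  let ?T = "{(n, m). n + m = k + axis i (1::nat)}"
  let ?S = "{(n, m). n + m = k}"
  let ?h = "\<lambda>(n, m). (n + axis i (1::nat), m)"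
  have inj: "inj_on ?h ?S" by (auto simp: inj_on_def)
  have "(\<Sum>(n, m)\<in>?T. c n * of_nat (n $ i) * d m)
      = (\<Sum>(n, m)\<in>?h ` ?S. c n * of_nat (n $ i) * d m)"
  proof (rule sum.mono_neutral_right)
    show "finite ?T" by (rule finite_vec_sum_eq)
    show "?h ` ?S \<subseteq> ?T" by (auto simp: ac_simps)
    show "\<forall>q\<in>?T - ?h ` ?S. (case q of (n, m) \<Rightarrow> c n * of_nat (n $ i) * d m) = 0"
    proof (safe, goal_cases)
      case (1 n m)
      have "n $ i = 0"
      proof (rule ccontr)
        assume "n $ i \<noteq> 0"
        then have n: "n = (n - axis i 1) + axis i 1" by (auto simp: vec_eq_iff axis_def)
        have "((n - axis i 1) + m) + axis i 1 = ((n - axis i 1) + axis i 1) + m"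
          by (simp add: ac_simps)
        also have "\<dots> = n + m" by (simp only: n[symmetric])
        also have "\<dots> = k + axis i 1" using 1 by blast
        finally have "(n - axis i 1) + m = k" by simp
        with n have "(n, m) \<in> ?h ` ?S" by (intro image_eqI[of _ _ "(n - axis i 1, m)"]) auto
        with 1 show False by simp
      qed
      then show ?case by simp
    qed
  qed
  also have "\<dots> = conv (row_d i c) d k"
    unfolding conv_def sum.reindex[OF inj]
    by (rule sum.cong) (auto simp: row_d_def axis_def mult_ac)
  finally show ?thesis ..
qed

lemma vf_deriv_conv:
  "vf_deriv A c = (\<lambda>k. \<Sum>i\<in>UNIV. conv (row_d i c) (vf_coeff A i) k)"
  by (simp add: vf_deriv_def conv_row_d_left)

lemma conv_commute: "conv c d = conv d c"
proof
  fix k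
  show "conv c d k = conv d c k"
    unfolding conv_def
    by (rule sum.reindex_bij_witness[of _ prod.swap prod.swap]) (auto simp: add.commute)
qed

lemma conv_add_left: "conv (\<lambda>k. c k + c' k) d = (\<lambda>k. conv c d k + conv c' d k)"
  by (simp add: conv_def fun_eq_iff algebra_simps sum.distrib case_prod_unfold)

lemma conv_scale_left: "conv (\<lambda>k. s * c k) d = (\<lambda>k. s * conv c d k)"
  by (simp add: conv_def fun_eq_iff algebra_simps sum_distrib_left case_prod_unfold)

lemma conv_sum_left: "conv (\<lambda>k. \<Sum>i\<in>I. c i k) d = (\<lambda>k. \<Sum>i\<in>I. conv (c i) d k)"
  by (simp add: conv_def fun_eq_iff sum_distrib_right case_prod_unfold sum.swap[of _ I])

lemma conv_sum_right: "conv d (\<lambda>k. \<Sum>i\<in>I. c i k) = (\<lambda>k. \<Sum>i\<in>I. conv d (c i) k)"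
  by (subst (1 2) conv_commute) (rule conv_sum_left)

lemma conv_assoc: "conv (conv a b) c = conv a (conv b c)"
proof
  fix k :: "nat ^ 'a"
  have "conv (conv a b) c k
      = (\<Sum>((s, m), (n, l))\<in>Sigma {(s, m). s + m = k} (\<lambda>(s, m). {(n, l). n + l = s}). a n * b l * c m)"
    unfolding conv_def sum_distrib_right case_prod_unfold
    by (subst sum.Sigma) (auto simp: finite_vec_sum_eq[unfolded case_prod_unfold] case_prod_unfold)
  also have "\<dots> = (\<Sum>((n, s), (l, m))\<in>Sigma {(n, s). n + s = k} (\<lambda>(n, s). {(l, m). l + m = s}). a n * (b l * c m))"
    by (rule sum.reindex_bij_witness[of _ "\<lambda>((n, s), (l, m)). ((n + l, m), (n, l))"
          "\<lambda>((s, m), (n, l)). ((n, l + m), (l, m))"]) (auto simp: algebra_simps)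
  also have "\<dots> = conv a (conv b c) k"
    unfolding conv_def sum_distrib_left case_prod_unfold
    by (subst sum.Sigma) (auto simp: finite_vec_sum_eq[unfolded case_prod_unfold] case_prod_unfold)
  finally show "conv (conv a b) c k = conv a (conv b c) k" .
qed

text \<open>
  On pairs with \<open>n + m = k + i(1)\<close> the factor \<open>k\<^sub>i + 1\<close> splits as \<open>n\<^sub>i + m\<^sub>i\<close>, which gives the two terms
  of the product rule.
\<close>

lemma row_d_conv: "row_d i (conv c d) = (\<lambda>k. conv (row_d i c) d k + conv c (row_d i d) k)"
proof
  fix k
  let ?T = "{(n, m). n + m = k + axis i (1::nat)}"
  have "row_d i (conv c d) k = (\<Sum>(n, m)\<in>?T. of_nat (k $ i + 1) * (c n * d m))"
    by (simp add: row_d_def conv_def sum_distrib_left case_prod_unfold)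
  also have "\<dots> = (\<Sum>(n, m)\<in>?T. c n * of_nat (n $ i) * d m + c n * (of_nat (m $ i) * d m))"
  proof (rule sum.cong, safe)
    fix n m assume "n + m = k + axis i (1::nat)"
    from arg_cong[OF this, of "\<lambda>v. v $ i"] have "k $ i + 1 = n $ i + m $ i" by simp
    then show "of_nat (k $ i + 1) * (c n * d m) = c n * of_nat (n $ i) * d m + c n * (of_nat (m $ i) * d m)"
      by (simp only: of_nat_add) (simp add: algebra_simps)
  qed
  also have "\<dots> = (\<Sum>(n, m)\<in>?T. c n * of_nat (n $ i) * d m) + (\<Sum>(n, m)\<in>?T. c n * (of_nat (m $ i) * d m))"
    by (simp add: sum.distrib case_prod_unfold)
  also have "(\<Sum>(n, m)\<in>?T. c n * (of_nat (m $ i) * d m)) = (\<Sum>(n, m)\<in>?T. d n * of_nat (n $ i) * c m)"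
    by (rule sum.reindex_bij_witness[of _ prod.swap prod.swap]) (auto simp: ac_simps)
  finally show "row_d i (conv c d) k = conv (row_d i c) d k + conv c (row_d i d) k"
    by (simp only: conv_row_d_left[symmetric] conv_commute[of c])
qed

lemma vf_deriv_add: "vf_deriv A (\<lambda>k. c k + d k) = (\<lambda>k. vf_deriv A c k + vf_deriv A d k)"
  by (simp add: vf_deriv_def algebra_simps sum.distrib case_prod_unfold)

lemma vf_deriv_scale: "vf_deriv A (\<lambda>k. s * c k) = (\<lambda>k. s * vf_deriv A c k)"
  by (simp add: vf_deriv_def sum_distrib_left mult.assoc case_prod_unfold)

text \<open>
  Each \<open>d\<^sub>i\<close> satisfies the product rule, and multiplying a derivation by a fixed series leaves a
  derivation since the Cauchy product is commutative and associative.
\<close>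

lemma vf_deriv_mult:
  "vf_deriv A (conv c d) = (\<lambda>k. conv (vf_deriv A c) d k + conv c (vf_deriv A d) k)"
proof -
  have 1: "conv (conv (row_d i c) d) a = conv (conv (row_d i c) a) d" for i a
    by (metis conv_assoc conv_commute)
  show ?thesis
    unfolding vf_deriv_conv row_d_conv conv_add_left conv_sum_left conv_sum_right sum.distrib 1
    unfolding conv_assoc ..
qed

lemma conv_row_basis: "conv (row_basis n) (row_basis m) = row_basis (n + m)"
proof
  fix k
  have "conv (row_basis n) (row_basis m) k
      = (\<Sum>q | fst q + snd q = k. if q = (n, m) then 1 else 0)"
    unfolding conv_def by (rule sum.cong) (auto simp: row_basis_def split: if_splits)
  then show "conv (row_basis n) (row_basis m) k = row_basis (n + m) k"
    using finite_vec_sum_eq[of k, unfolded case_prod_unfold] by (auto simp: row_basis_def)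
qed

lemma conv_row_basis_0: "conv (row_basis 0) c = c"
proof
  fix k
  have "conv (row_basis 0) c k = (\<Sum>q | fst q + snd q = k. if q = (0, k) then c k else 0)"
    unfolding conv_def by (rule sum.cong) (auto simp: row_basis_def split: if_splits)
  then show "conv (row_basis 0) c k = c k"
    using finite_vec_sum_eq[of k, unfolded case_prod_unfold] by auto
qed

lemma row_d_basis_axis: "row_d j (row_basis (axis i 1)) = (\<lambda>k. (if j = i then 1 else 0) * row_basis 0 k)"
proof
  fix k
  have "k + axis j 1 = axis i (1::nat) \<longleftrightarrow> j = i \<and> k = 0"
  proof
    assume eq: "k + axis j 1 = axis i (1::nat)"
    from arg_cong[OF this, of "\<lambda>v. v $ j"] have "j = i" by (auto simp: axis_def split: if_splits)
    with eq show "j = i \<and> k = 0" by simp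
  qed simp
  then show "row_d j (row_basis (axis i 1)) k = (if j = i then 1 else 0) * row_basis 0 k"
    by (auto simp: row_d_def row_basis_def)
qed

lemma vf_deriv_basis_axis: "vf_deriv A (row_basis (axis i 1)) = vf_coeff A i"
proof
  fix k
  have "vf_deriv A (row_basis (axis i 1)) k = (\<Sum>j\<in>UNIV. if j = i then vf_coeff A j k else 0)"
    unfolding vf_deriv_conv row_d_basis_axis conv_scale_left conv_row_basis_0
    by (rule sum.cong) auto
  then show "vf_deriv A (row_basis (axis i 1)) k = vf_coeff A i k" by simp
qed

lemma vf_deriv_basis_0: "vf_deriv A (row_basis 0) = (\<lambda>_. 0)"
  unfolding vf_deriv_def row_basis_def by (auto intro!: sum.neutral)

section \<open>Weighted coefficient norms\<close>

text \<open>
  \<open>wbound r c B\<close> expresses \<open>\<Sum>\<^sub>n \<bar>c\<^sub>n\<bar> r\<^bsup>\<bar>n\<bar>\<^esup> \<le> B\<close> through finite partial sums, so that norm estimates need no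
  separate discussion of summability.
\<close>

definition wbound :: "real \<Rightarrow> 'p::finite row_series \<Rightarrow> real \<Rightarrow> bool" where
  "wbound r c B \<longleftrightarrow> (\<forall>F. finite F \<longrightarrow> (\<Sum>n\<in>F. norm (c n) * r ^ mdeg n) \<le> B)"

lemma wboundI: "(\<And>F. finite F \<Longrightarrow> (\<Sum>n\<in>F. norm (c n) * r ^ mdeg n) \<le> B) \<Longrightarrow> wbound r c B"
  by (simp add: wbound_def)

lemma wboundD: "wbound r c B \<Longrightarrow> finite F \<Longrightarrow> (\<Sum>n\<in>F. norm (c n) * r ^ mdeg n) \<le> B"
  by (simp add: wbound_def)

lemma wbound_nonneg: "wbound r c B \<Longrightarrow> 0 \<le> B"
  using wboundD[of r c B "{}"] by simp

lemma wbound_antimono: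
  assumes "wbound r c B" "0 \<le> s" "s \<le> r"
  shows "wbound s c B"
proof (rule wboundI)
  fix F :: "(nat ^ 'a) set" assume "finite F"
  have "(\<Sum>n\<in>F. norm (c n) * s ^ mdeg n) \<le> (\<Sum>n\<in>F. norm (c n) * r ^ mdeg n)"
    using assms by (intro sum_mono mult_left_mono power_mono) auto
  also have "\<dots> \<le> B" using assms(1) \<open>finite F\<close> by (rule wboundD)
  finally show "(\<Sum>n\<in>F. norm (c n) * s ^ mdeg n) \<le> B" .
qed

lemma wbound_conv:
  assumes c: "wbound r c B" and d: "wbound r d C" and r: "0 \<le> r"
  shows "wbound r (conv c d) (B * C)"
proof (rule wboundI)
  fix F :: "(nat ^ 'a) set" assume F: "finite F"
  define S where "S = Sigma F (\<lambda>k. {(n, m). n + m = k})"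
  have S: "finite S" unfolding S_def using F by (intro finite_SigmaI finite_vec_sum_eq)
  define N where "N = (\<lambda>(k, n, m). n) ` S"
  define M where "M = (\<lambda>(k, n, m). m) ` S"
  define g where "g = (\<lambda>(n, m). (norm (c n) * r ^ mdeg n) * (norm (d m) * r ^ mdeg m))"
  have g0: "0 \<le> g q" for q using r by (auto simp: g_def split: prod.split)
  have "(\<Sum>k\<in>F. norm (conv c d k) * r ^ mdeg k)
      \<le> (\<Sum>k\<in>F. \<Sum>q\<in>{(n, m). n + m = k}. g q)"
  proof (rule sum_mono)
    fix k
    have "norm (conv c d k) * r ^ mdeg k \<le> (\<Sum>(n, m) | n + m = k. norm (c n * d m)) * r ^ mdeg k"
      unfolding conv_def case_prod_unfold using r by (intro mult_right_mono norm_sum) auto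
    also have "\<dots> = (\<Sum>q\<in>{(n, m). n + m = k}. g q)"
      unfolding sum_distrib_right
      by (rule sum.cong) (auto simp: g_def mdeg_add power_add norm_mult mult_ac)
    finally show "norm (conv c d k) * r ^ mdeg k \<le> (\<Sum>q\<in>{(n, m). n + m = k}. g q)" .
  qed
  also have "\<dots> = (\<Sum>(k, q)\<in>S. g q)"
    unfolding S_def using F finite_vec_sum_eq by (subst sum.Sigma) auto
  also have "\<dots> = (\<Sum>q\<in>snd ` S. g q)"
    by (subst sum.reindex) (auto simp: inj_on_def S_def case_prod_unfold)
  also have "\<dots> \<le> (\<Sum>q\<in>N \<times> M. g q)"
  proof (rule sum_mono2)
    show "snd ` S \<subseteq> N \<times> M" by (force simp: N_def M_def)
  qed (use S g0 in \<open>auto simp: N_def M_def\<close>)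
  also have "\<dots> = (\<Sum>n\<in>N. norm (c n) * r ^ mdeg n) * (\<Sum>m\<in>M. norm (d m) * r ^ mdeg m)"
    by (simp add: g_def sum_product sum.cartesian_product)
  also have "\<dots> \<le> B * C"
  proof (rule mult_mono)
    show "(\<Sum>n\<in>N. norm (c n) * r ^ mdeg n) \<le> B" using c S by (auto intro!: wboundD simp: N_def)
    show "(\<Sum>n\<in>M. norm (d n) * r ^ mdeg n) \<le> C" using d S by (auto intro!: wboundD simp: M_def)
  qed (use wbound_nonneg[OF c] r in \<open>auto intro!: sum_nonneg\<close>)
  finally show "(\<Sum>k\<in>F. norm (conv c d k) * r ^ mdeg k) \<le> B * C" .
qed

text \<open>
  This is the Cauchy estimate for coefficients: \<open>(d + 1) r\<^sup>d \<delta>\<close> is one of the terms in the binomial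
  expansion of \<open>(r + \<delta>)\<^bsup>d+1\<^esup>\<close>.
\<close>

lemma wbound_row_d:
  assumes c: "wbound (r + \<delta>) c B" and r: "0 \<le> r" and \<delta>: "0 < \<delta>"
  shows "wbound r (row_d i c) (B / \<delta>)"
proof (rule wboundI)
  fix F :: "(nat ^ 'a) set" assume F: "finite F"
  let ?h = "\<lambda>k. k + axis i (1::nat)"
  have "(\<Sum>k\<in>F. norm (row_d i c k) * r ^ mdeg k) * \<delta>
      \<le> (\<Sum>k\<in>F. norm (c (?h k)) * (r + \<delta>) ^ mdeg (?h k))"
    unfolding sum_distrib_right
  proof (rule sum_mono)
    fix k :: "nat ^ 'a"
    let ?d = "mdeg k"
    have "real (k $ i + 1) * r ^ ?d * \<delta> \<le> real (?d + 1) * r ^ ?d * \<delta>"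
      using r \<delta> component_le_mdeg[of k i] by (intro mult_right_mono) auto
    \<comment> \<open>Rewritten as the term \<open>j = 1\<close> of the binomial expansion.\<close>
    also have "\<dots> = real (Suc ?d) * (\<delta> ^ 1 * r ^ (Suc ?d - 1))" by simp
    also have "\<dots> = real (Suc ?d choose 1) * \<delta> ^ 1 * r ^ (Suc ?d - 1)"
      by (simp only: choose_one mult.assoc)
    also have "\<dots> \<le> (\<Sum>j\<le>Suc ?d. real (Suc ?d choose j) * \<delta> ^ j * r ^ (Suc ?d - j))"
      by (rule member_le_sum) (use r \<delta> in auto)
    also have "\<dots> = (r + \<delta>) ^ Suc ?d"
      by (simp only: binomial_ring add.commute[of r \<delta>] of_nat_id)
    finally have "real (k $ i + 1) * r ^ ?d * \<delta> \<le> (r + \<delta>) ^ Suc ?d" .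
    then have "norm (c (?h k)) * (real (k $ i + 1) * r ^ ?d * \<delta>)
        \<le> norm (c (?h k)) * (r + \<delta>) ^ Suc ?d"
      by (rule mult_left_mono) simp
    moreover have "norm (row_d i c k) = real (k $ i + 1) * norm (c (?h k))"
      by (simp only: row_d_def norm_mult norm_of_nat)
    ultimately show "norm (row_d i c k) * r ^ ?d * \<delta> \<le> norm (c (?h k)) * (r + \<delta>) ^ mdeg (?h k)"
      by (simp add: mdeg_add mdeg_axis[simplified] algebra_simps)
  qed
  also have "\<dots> = (\<Sum>n\<in>?h ` F. norm (c n) * (r + \<delta>) ^ mdeg n)"
    by (subst sum.reindex) (auto simp: inj_on_def)
  also have "\<dots> \<le> B" using c F by (intro wboundD) auto
  finally show "(\<Sum>k\<in>F. norm (row_d i c k) * r ^ mdeg k) \<le> B / \<delta>"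
    using \<delta> by (simp add: field_simps)
qed

lemma wbound_sum:
  assumes "\<And>i. i \<in> I \<Longrightarrow> wbound r (c i) (B i)" and r: "0 \<le> r"
  shows "wbound r (\<lambda>k. \<Sum>i\<in>I. c i k) (\<Sum>i\<in>I. B i)"
proof (rule wboundI)
  fix F :: "(nat ^ 'b) set" assume F: "finite F"
  have "(\<Sum>n\<in>F. norm (\<Sum>i\<in>I. c i n) * r ^ mdeg n) \<le> (\<Sum>n\<in>F. (\<Sum>i\<in>I. norm (c i n)) * r ^ mdeg n)"
    using r by (intro sum_mono mult_right_mono norm_sum) auto
  also have "\<dots> = (\<Sum>i\<in>I. \<Sum>n\<in>F. norm (c i n) * r ^ mdeg n)"
    by (simp add: sum_distrib_right sum.swap[of _ I])
  also have "\<dots> \<le> (\<Sum>i\<in>I. B i)"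
    using assms F by (intro sum_mono wboundD) auto
  finally show "(\<Sum>n\<in>F. norm (\<Sum>i\<in>I. c i n) * r ^ mdeg n) \<le> (\<Sum>i\<in>I. B i)" .
qed

lemma wbound_vf_deriv:
  assumes c: "wbound (r + \<delta>) c B" and a: "\<And>i. wbound r (vf_coeff A i) (M i)"
    and r: "0 \<le> r" and \<delta>: "0 < \<delta>"
  shows "wbound r (vf_deriv A c) ((\<Sum>i\<in>UNIV. M i) / \<delta> * B)"
proof -
  have "wbound r (vf_deriv A c) (\<Sum>i\<in>UNIV. B / \<delta> * M i)"
    unfolding vf_deriv_conv
    by (intro wbound_sum wbound_conv wbound_row_d assms)
  moreover have "(\<Sum>i\<in>UNIV. B / \<delta> * M i) = (\<Sum>i\<in>UNIV. M i) / \<delta> * B"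
    unfolding sum_distrib_left[symmetric] by simp
  ultimately show ?thesis by simp
qed

lemma wbound_vf_deriv_iterate:
  assumes a: "\<And>i. wbound R' (vf_coeff A i) (M i)" and \<delta>: "0 < \<delta>"
    and c: "wbound (r + real n * \<delta>) c B" and "0 \<le> r" "r + real n * \<delta> \<le> R'"
  shows "wbound r ((vf_deriv A ^^ n) c) (((\<Sum>i\<in>UNIV. M i) / \<delta>) ^ n * B)"
  using c assms(4,5)
proof (induction n arbitrary: r)
  case 0
  then show ?case by simp
next
  case (Suc n)
  have "wbound (r + \<delta>) ((vf_deriv A ^^ n) c) (((\<Sum>i\<in>UNIV. M i) / \<delta>) ^ n * B)"
    using Suc.prems \<delta> by (intro Suc.IH) (simp_all add: algebra_simps)
  moreover have "wbound r (vf_coeff A i) (M i)" for i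
  proof (rule wbound_antimono[OF a])
    have "0 \<le> real (Suc n) * \<delta>" using \<delta> by simp
    then show "r \<le> R'" using Suc.prems(3) by linarith
  qed fact
  ultimately have "wbound r (vf_deriv A ((vf_deriv A ^^ n) c))
      ((\<Sum>i\<in>UNIV. M i) / \<delta> * (((\<Sum>i\<in>UNIV. M i) / \<delta>) ^ n * B))"
    using Suc.prems \<delta> by (intro wbound_vf_deriv)
  then show ?case by (simp add: mult.assoc)
qed

text \<open>
  The left-hand side divided by \<open>n!\<close> is one term of the exponential series of \<open>n\<close>.
\<close>

lemma power_self_le_fact_exp: "real n ^ n \<le> fact n * exp 1 ^ n"
proof -
  have "real n ^ n / fact n \<le> (\<Sum>k. real n ^ k / fact k)"
    using sum_le_suminf[OF summable_exp[of "real n"], of "{n}"]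
    by (simp add: divide_inverse mult.commute)
  also have "\<dots> = exp (real n)"
    by (simp add: exp_def divide_inverse mult.commute)
  also have "\<dots> = exp 1 ^ n"
    using exp_of_nat_mult[of n "1::real"] by simp
  finally show ?thesis by (simp add: field_simps)
qed

text \<open>
  Each of the \<open>n\<close> applications of \<open>D\<^sub>A\<close> is given the share \<open>1/n\<close> of the available radius. The loss
  \<open>n\<^sup>n\<close> is then absorbed by the factorial, which is what makes the Lie series converge.
\<close>

lemma wbound_vf_deriv_fact:
  assumes a: "\<And>i. wbound (R + 1) (vf_coeff A i) (M i)"
    and c: "wbound (R + 1) c B" and R: "0 \<le> R"
  shows "wbound R ((vf_deriv A ^^ n) c) (fact n * ((\<Sum>i\<in>UNIV. M i) * exp 1) ^ n * B)"
proof -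
  let ?M = "\<Sum>i\<in>UNIV. M i"
  have M: "0 \<le> ?M" using a by (intro sum_nonneg wbound_nonneg)
  have B: "0 \<le> B" using c by (rule wbound_nonneg)
  have mono: "wbound R d C \<Longrightarrow> C \<le> C' \<Longrightarrow> wbound R d C'" for d :: "'a row_series" and C C'
    by (force simp: wbound_def)
  show ?thesis
  proof (cases "n = 0")
    case True
    then show ?thesis using wbound_antimono[OF c R] by simp
  next
    case False
    have "wbound R ((vf_deriv A ^^ n) c) ((?M / (1 / real n)) ^ n * B)"
      using False c R by (intro wbound_vf_deriv_iterate[OF a]) auto
    moreover have "(?M / (1 / real n)) ^ n * B \<le> fact n * (?M * exp 1) ^ n * B"
    proof -
      have "(?M / (1 / real n)) ^ n * B = ?M ^ n * real n ^ n * B"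
        by (simp add: power_mult_distrib)
      also have "\<dots> \<le> ?M ^ n * (fact n * exp 1 ^ n) * B"
        using M B by (intro mult_right_mono mult_left_mono power_self_le_fact_exp) auto
      also have "\<dots> = fact n * (?M * exp 1) ^ n * B"
        unfolding power_mult_distrib by (simp only: mult.assoc mult.left_commute)
      finally show ?thesis .
    qed
    ultimately show ?thesis by (rule mono)
  qed
qed

lemma entire_series_wbound_summable:
  assumes "entire_series c" "0 \<le> r"
  shows "(\<lambda>n. norm (c n) * r ^ mdeg n) summable_on UNIV"
proof -
  define w :: "complex ^ 'a" where "w = (\<chi> i. of_real r)"
  have "norm (mpow w n) = r ^ mdeg n" for n
    using assms(2) by (simp add: norm_mpow w_def mdeg_def power_sum)
  moreover have "(\<lambda>n. norm (c n * mpow w n)) summable_on UNIV"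
    using assms(1) unfolding entire_series_def summable_on_iff_abs_summable_on_complex by blast
  ultimately show ?thesis by (simp add: norm_mult)
qed

lemma entire_series_wbound:
  assumes "entire_series c" "0 \<le> r"
  shows "wbound r c (\<Sum>\<^sub>\<infinity>n. norm (c n) * r ^ mdeg n)"
  by (rule wboundI, rule finite_sum_le_infsum[OF entire_series_wbound_summable[OF assms]])
     (use assms in auto)

lemma wbound_infsum_le:
  assumes "entire_series c" "0 \<le> r" "wbound r c B"
  shows "(\<Sum>\<^sub>\<infinity>n. norm (c n) * r ^ mdeg n) \<le> B"
  by (rule infsum_le_finite_sums[OF entire_series_wbound_summable])
     (use assms in \<open>auto intro: wboundD\<close>)

section \<open>Values of entire series\<close>

definition series_val :: "'p::finite row_series \<Rightarrow> complex ^ 'p \<Rightarrow> complex" where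
  "series_val c z = (\<Sum>\<^sub>\<infinity>n. c n * mpow z n)"

lemma has_sum_series_val:
  "entire_series c \<Longrightarrow> ((\<lambda>n. c n * mpow z n) has_sum series_val c z) UNIV"
  unfolding series_val_def entire_series_def by (blast intro: has_sum_infsum)

lemma norm_series_val_le:
  assumes c: "entire_series c" "wbound R c B" and z: "\<And>i. norm (z $ i) \<le> R"
  shows "norm (series_val c z) \<le> B"
proof -
  have R: "0 \<le> R" using norm_ge_zero z order_trans by blast
  have "norm (series_val c z) \<le> (\<Sum>\<^sub>\<infinity>n. norm (c n) * R ^ mdeg n)"
  proof (rule norm_infsum_le[OF has_sum_series_val[OF c(1)]])
    show "((\<lambda>n. norm (c n) * R ^ mdeg n) has_sum (\<Sum>\<^sub>\<infinity>n. norm (c n) * R ^ mdeg n)) UNIV"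
      by (intro has_sum_infsum entire_series_wbound_summable c R)
    show "norm (c n * mpow z n) \<le> norm (c n) * R ^ mdeg n" for n
      unfolding norm_mult by (intro mult_left_mono norm_mpow_le z) auto
  qed
  also have "\<dots> \<le> B" using c R by (intro wbound_infsum_le)
  finally show ?thesis .
qed

lemma entire_series_add: "entire_series c \<Longrightarrow> entire_series d \<Longrightarrow> entire_series (\<lambda>k. c k + d k)"
  unfolding entire_series_def distrib_right by (auto intro: summable_on_add)

lemma entire_series_scale: "entire_series c \<Longrightarrow> entire_series (\<lambda>k. s * c k)"
  unfolding entire_series_def mult.assoc by (auto intro: summable_on_cmult_right)

lemma series_val_add:
  "entire_series c \<Longrightarrow> entire_series d \<Longrightarrow> series_val (\<lambda>k. c k + d k) z = series_val c z + series_val d z"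
  unfolding series_val_def entire_series_def distrib_right by (intro infsum_add) auto

lemma series_val_scale: "series_val (\<lambda>k. s * c k) z = s * series_val c z"
  unfolding series_val_def mult.assoc by (rule infsum_cmult_right')

text \<open>
  The absolutely convergent double series is regrouped along the finite sets \<open>n + m = k\<close>.
\<close>

lemma has_sum_conv:
  assumes "entire_series c" "entire_series d"
  shows "((\<lambda>k. conv c d k * mpow z k) has_sum (series_val c z * series_val d z)) UNIV"
proof -
  define f where "f = (\<lambda>(n, m). (c n * mpow z n) * (d m * mpow z m))"
  have abs: "(\<lambda>n. norm (c n * mpow z n)) summable_on UNIV" "(\<lambda>n. norm (d n * mpow z n)) summable_on UNIV"
    using assms unfolding entire_series_def summable_on_iff_abs_summable_on_complex by blast+
  have "(\<lambda>q. norm (f q)) summable_on UNIV \<times> UNIV"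
    unfolding Infinite_Sum.abs_summable_on_Sigma_iff f_def prod.case norm_mult[of "c _ * mpow z _"]
    using abs
    by (simp add: abs_mult infsum_nonneg infsum_cmult_right' summable_on_cmult_right summable_on_cmult_left)
  then have summ: "f summable_on UNIV \<times> UNIV" by (rule abs_summable_summable)
  have "(f has_sum (series_val c z * series_val d z)) (UNIV \<times> UNIV)"
  proof (rule has_sum_SigmaI[OF _ _ summ])
    show "((\<lambda>m. f (n, m)) has_sum (c n * mpow z n * series_val d z)) UNIV" for n
      unfolding f_def prod.case by (intro has_sum_cmult_right has_sum_series_val assms)
    show "((\<lambda>n. c n * mpow z n * series_val d z) has_sum series_val c z * series_val d z) UNIV"
      by (intro has_sum_cmult_left has_sum_series_val assms)
  qed
  also have "UNIV \<times> UNIV = snd ` Sigma UNIV (\<lambda>k. {(n, m). n + m = (k :: nat ^ 'a)})"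
    by force
  finally have "((\<lambda>q. f (snd q)) has_sum (series_val c z * series_val d z))
      (Sigma UNIV (\<lambda>k. {(n, m). n + m = (k :: nat ^ 'a)}))"
    by (subst (asm) has_sum_reindex) (auto simp: inj_on_def o_def)
  then show ?thesis
  proof (rule has_sum_SigmaD)
    fix k :: "nat ^ 'a"
    have "conv c d k * mpow z k = sum f {(n, m). n + m = k}"
      unfolding conv_def sum_distrib_right
      by (rule sum.cong) (auto simp: f_def mpow_add)
    then show "((\<lambda>y. f (snd (k, y))) has_sum conv c d k * mpow z k) {(n, m). n + m = k}"
      using finite_vec_sum_eq by (auto intro!: has_sum_finiteI)
  qed
qed

lemma entire_series_conv: "entire_series c \<Longrightarrow> entire_series d \<Longrightarrow> entire_series (conv c d)"
  using has_sum_conv unfolding entire_series_def summable_on_def by blast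

lemma series_val_conv:
  "entire_series c \<Longrightarrow> entire_series d \<Longrightarrow> series_val (conv c d) z = series_val c z * series_val d z"
  unfolding series_val_def[of "conv c d"] by (intro infsumI has_sum_conv)

lemma series_val_row_basis: "series_val (row_basis n) z = mpow z n"
proof -
  have "(\<Sum>\<^sub>\<infinity>m. row_basis n m * mpow z m) = (\<Sum>\<^sub>\<infinity>m\<in>{n}. row_basis n m * mpow z m)"
    by (rule infsum_cong_neutral) (auto simp: row_basis_def)
  then show ?thesis by (simp add: series_val_def row_basis_def)
qed

lemma exp_d_list_basis_0: "exp_d_list index_list x (row_basis n) 0 = mpow x n"
  by (simp add: exp_d_list_basis index_list mpow_def)

text \<open>
  Taking the constant coefficient after translation by \<open>x\<close> is evaluation at \<open>x\<close>.
\<close>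

lemma counit_exp_xd: "counit (exp_xd x c) = series_val c x"
  by (simp add: counit_def exp_xd_def series_val_def exp_d_list_basis_0)

section \<open>Lie series\<close>

text \<open>
  Dividing by \<open>n!\<close> turns the Leibniz formula into the Cauchy product of coefficient sequences.
\<close>

definition lie_coeff ::
    "(complex ^ 'p::finite \<Rightarrow> complex ^ 'p) \<Rightarrow> complex ^ 'p \<Rightarrow> 'p row_series \<Rightarrow> nat \<Rightarrow> complex" where
  "lie_coeff A x c n = series_val ((vf_deriv A ^^ n) c) x / fact n"

definition lie_exp ::
    "(complex ^ 'p::finite \<Rightarrow> complex ^ 'p) \<Rightarrow> complex ^ 'p \<Rightarrow> complex \<Rightarrow> 'p row_series \<Rightarrow> complex" where
  "lie_exp A x t c = (\<Sum>n. lie_coeff A x c n * t ^ n)"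

lemma entire_series_vf_deriv_iterate:
  "analytic_vf A \<Longrightarrow> entire_series c \<Longrightarrow> entire_series ((vf_deriv A ^^ n) c)"
  by (induction n) (auto intro: entire_series_vf_deriv)

lemma vf_deriv_iterate_add:
  "(vf_deriv A ^^ n) (\<lambda>k. c k + d k) = (\<lambda>k. (vf_deriv A ^^ n) c k + (vf_deriv A ^^ n) d k)"
  by (induction n) (simp_all add: vf_deriv_add)

lemma vf_deriv_iterate_scale:
  "(vf_deriv A ^^ n) (\<lambda>k. s * c k) = (\<lambda>k. s * (vf_deriv A ^^ n) c k)"
  by (induction n) (simp_all add: vf_deriv_scale)

text \<open>
  Pascal's rule in the form required by the induction for the Leibniz formula.
\<close>

lemma sum_choose_step:
  fixes u :: "nat \<Rightarrow> nat \<Rightarrow> 'a::comm_semiring_1"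
  shows "(\<Sum>l\<le>n. of_nat (n choose l) * u (Suc l) (n - l)) + (\<Sum>l\<le>n. of_nat (n choose l) * u l (Suc (n - l)))
    = (\<Sum>l\<le>Suc n. of_nat (Suc n choose l) * u l (Suc n - l))"
proof -
  have "(\<Sum>l\<le>n. of_nat (n choose l) * u l (Suc (n - l))) = (\<Sum>l\<le>Suc n. of_nat (n choose l) * u l (Suc n - l))"
    by (simp add: Suc_diff_le binomial_eq_0)
  also have "\<dots> = u 0 (Suc n) + (\<Sum>l\<le>n. of_nat (n choose Suc l) * u (Suc l) (n - l))"
    by (subst sum.atMost_Suc_shift) simp
  finally have "(\<Sum>l\<le>n. of_nat (n choose l) * u l (Suc (n - l)))
      = u 0 (Suc n) + (\<Sum>l\<le>n. of_nat (n choose Suc l) * u (Suc l) (n - l))" .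
  moreover have "(\<Sum>l\<le>Suc n. of_nat (Suc n choose l) * u l (Suc n - l))
      = u 0 (Suc n) + (\<Sum>l\<le>n. of_nat (n choose l) * u (Suc l) (n - l)
          + of_nat (n choose Suc l) * u (Suc l) (n - l))"
    by (subst sum.atMost_Suc_shift) (simp add: distrib_right)
  ultimately show ?thesis
    by (simp add: sum.distrib add.left_commute)
qed

text \<open>
  The Leibniz formula for iterates of a derivation. Stating it for values at \<open>x\<close> rather than for
  series reduces the induction step to an identity between numbers. The innermost application of \<open>D\<^sub>A\<close> is
  expanded first, which is why the series are generalized.
\<close>

lemma series_val_vf_deriv_conv:
  assumes A: "analytic_vf A" and "entire_series c" "entire_series d"
  shows "series_val ((vf_deriv A ^^ n) (conv c d)) x
    = (\<Sum>l\<le>n. of_nat (n choose l) * (series_val ((vf_deriv A ^^ l) c) x * series_val ((vf_deriv A ^^ (n - l)) d) x))"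
  using assms(2,3)
proof (induction n arbitrary: c d)
  case 0
  then show ?case by (simp add: series_val_conv)
next
  case (Suc n)
  note D = entire_series_vf_deriv[OF A]
  have "series_val ((vf_deriv A ^^ Suc n) (conv c d)) x
      = series_val ((vf_deriv A ^^ n) (conv (vf_deriv A c) d)) x
        + series_val ((vf_deriv A ^^ n) (conv c (vf_deriv A d))) x"
    unfolding funpow_Suc_right o_def vf_deriv_mult vf_deriv_iterate_add
    by (intro series_val_add entire_series_vf_deriv_iterate A entire_series_conv D Suc.prems)
  also have "\<dots> = (\<Sum>l\<le>Suc n. of_nat (Suc n choose l) * (series_val ((vf_deriv A ^^ l) c) x
      * series_val ((vf_deriv A ^^ (Suc n - l)) d) x))"
    unfolding Suc.IH[OF D[OF Suc.prems(1)] Suc.prems(2)] Suc.IH[OF Suc.prems(1) D[OF Suc.prems(2)]]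
    using sum_choose_step[of n "\<lambda>l m. series_val ((vf_deriv A ^^ l) c) x * series_val ((vf_deriv A ^^ m) d) x"]
    by (simp only: funpow_Suc_right o_def)
  finally show ?case .
qed

lemma lie_coeff_conv:
  assumes "analytic_vf A" "entire_series c" "entire_series d"
  shows "lie_coeff A x (conv c d) n = (\<Sum>l\<le>n. lie_coeff A x c l * lie_coeff A x d (n - l))"
  unfolding lie_coeff_def series_val_vf_deriv_conv[OF assms] sum_divide_distrib
proof (rule sum.cong)
  fix l assume "l \<in> {..n}"
  then have "of_nat (n choose l) = (fact n / (fact l * fact (n - l)) :: complex)"
    by (intro binomial_fact) auto
  then show "of_nat (n choose l) * (series_val ((vf_deriv A ^^ l) c) x * series_val ((vf_deriv A ^^ (n - l)) d) x) / fact n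
      = series_val ((vf_deriv A ^^ l) c) x / fact l * (series_val ((vf_deriv A ^^ (n - l)) d) x / fact (n - l))"
    by simp
qed simp

lemma lie_coeff_vf_deriv: "lie_coeff A x (vf_deriv A c) n = of_nat (Suc n) * lie_coeff A x c (Suc n)"
  by (simp add: lie_coeff_def funpow_swap1 del: of_nat_Suc)

text \<open>
  The initial values \<open>x\<close> range over the polydisc of radius \<open>R\<close>; the margin \<open>1\<close> in \<open>R + 1\<close> is the radius
  that the iterates of \<open>D\<^sub>A\<close> may use up.
\<close>

locale majorized_vf =
  fixes A :: "complex ^ 'p::finite \<Rightarrow> complex ^ 'p" and R :: real and M :: "'p \<Rightarrow> real"
  assumes analytic: "analytic_vf A"
    and R_nonneg: "0 \<le> R"
    and coeff_bound: "\<And>i. wbound (R + 1) (vf_coeff A i) (M i)"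
begin

text \<open>
  The Lie series converge when \<open>\<bar>t\<bar> rate < 1\<close>, uniformly in \<open>x\<close> in the polydisc of radius \<open>R\<close>.
\<close>

definition rate :: real where
  "rate = (\<Sum>i\<in>UNIV. M i) * exp 1"

lemma rate_nonneg: "0 \<le> rate"
  unfolding rate_def by (intro mult_nonneg_nonneg sum_nonneg wbound_nonneg[OF coeff_bound]) auto

lemma norm_lie_coeff_le:
  assumes c: "entire_series c" "wbound (R + 1) c B" and x: "\<And>i. norm (x $ i) \<le> R"
  shows "norm (lie_coeff A x c n) \<le> rate ^ n * B"
proof -
  have "norm (series_val ((vf_deriv A ^^ n) c) x) \<le> fact n * rate ^ n * B"
    unfolding rate_def
    by (intro norm_series_val_le[OF _ wbound_vf_deriv_fact[OF coeff_bound]]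
        entire_series_vf_deriv_iterate analytic c x R_nonneg)
  then show ?thesis
    by (simp add: lie_coeff_def norm_divide field_simps)
qed

context
  fixes x :: "complex ^ 'p" and t :: complex
  assumes x: "\<And>i. norm (x $ i) \<le> R" and t: "norm t * rate < 1"
begin

lemma norm_lie_term_le:
  assumes "entire_series c" "wbound (R + 1) c B"
  shows "norm (lie_coeff A x c n * t ^ n) \<le> (norm t * rate) ^ n * B"
proof -
  have "norm (lie_coeff A x c n * t ^ n) \<le> rate ^ n * B * norm t ^ n"
    unfolding norm_mult norm_power by (intro mult_right_mono norm_lie_coeff_le assms x) simp
  then show ?thesis by (simp add: power_mult_distrib mult.assoc mult.left_commute mult.commute[of B])
qed

lemma geometric_majorant: "(\<lambda>n. (norm t * rate) ^ n * B) sums (B / (1 - norm t * rate))"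
  using sums_mult2[OF geometric_sums[of "norm t * rate"], of B] t rate_nonneg by simp

lemma summable_norm_lie_terms:
  assumes c: "entire_series c"
  shows "summable (\<lambda>n. norm (lie_coeff A x c n * t ^ n))"
proof -
  obtain B where B: "wbound (R + 1) c B" using entire_series_wbound[OF c, of "R + 1"] R_nonneg by auto
  show ?thesis
  proof (rule summable_comparison_test)
    show "\<exists>N. \<forall>n\<ge>N. norm (norm (lie_coeff A x c n * t ^ n)) \<le> (norm t * rate) ^ n * B"
      using norm_lie_term_le[OF c B] by auto
    show "summable (\<lambda>n. (norm t * rate) ^ n * B)"
      using geometric_majorant by (rule sums_summable)
  qed
qed

lemmas summable_lie_terms = summable_norm_cancel[OF summable_norm_lie_terms]

lemma norm_lie_exp_le:
  assumes c: "entire_series c" "wbound (R + 1) c B"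
  shows "norm (lie_exp A x t c) \<le> B / (1 - norm t * rate)"
proof -
  have "norm (lie_exp A x t c) \<le> (\<Sum>n. norm (lie_coeff A x c n * t ^ n))"
    unfolding lie_exp_def by (intro summable_norm summable_norm_lie_terms c)
  also have "\<dots> \<le> (\<Sum>n. (norm t * rate) ^ n * B)"
    by (intro suminf_le norm_lie_term_le summable_norm_lie_terms c sums_summable[OF geometric_majorant])
  also have "\<dots> = B / (1 - norm t * rate)"
    using geometric_majorant sums_unique by metis
  finally show ?thesis .
qed

lemma lie_exp_add:
  assumes "entire_series c" "entire_series d"
  shows "lie_exp A x t (\<lambda>k. c k + d k) = lie_exp A x t c + lie_exp A x t d"
proof -
  have "lie_coeff A x (\<lambda>k. c k + d k) n = lie_coeff A x c n + lie_coeff A x d n" for n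
    unfolding lie_coeff_def vf_deriv_iterate_add
    using assms analytic by (simp add: series_val_add entire_series_vf_deriv_iterate add_divide_distrib)
  then show ?thesis
    by (simp add: lie_exp_def distrib_right suminf_add[symmetric] summable_lie_terms assms)
qed

lemma lie_exp_scale:
  assumes "entire_series c"
  shows "lie_exp A x t (\<lambda>k. s * c k) = s * lie_exp A x t c"
proof -
  have "lie_coeff A x (\<lambda>k. s * c k) n = s * lie_coeff A x c n" for n
    by (simp add: lie_coeff_def vf_deriv_iterate_scale series_val_scale)
  then show ?thesis
    by (simp add: lie_exp_def mult.assoc suminf_mult summable_lie_terms assms)
qed

text \<open>
  The operator \<open>e\<^bsup>tD\<^esup>\<close> of a derivation \<open>D\<close> is an algebra homomorphism: by the Leibniz formula the Lie series of a
  product is the Cauchy product of the two Lie series.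
\<close>

lemma lie_exp_mult:
  assumes "entire_series c" "entire_series d"
  shows "lie_exp A x t (conv c d) = lie_exp A x t c * lie_exp A x t d"
proof -
  have "lie_coeff A x (conv c d) n * t ^ n
      = (\<Sum>l\<le>n. (lie_coeff A x c l * t ^ l) * (lie_coeff A x d (n - l) * t ^ (n - l)))" for n
    unfolding lie_coeff_conv[OF analytic assms] sum_distrib_right
    by (rule sum.cong) (auto simp: power_add[symmetric] mult.assoc mult.left_commute)
  then show ?thesis
    unfolding lie_exp_def
    using sums_unique[OF Cauchy_product_sums[OF summable_norm_lie_terms summable_norm_lie_terms, OF assms]]
    by simp
qed

lemma lie_exp_row_basis_0: "lie_exp A x t (row_basis 0) = 1"
proof -
  have zero: "(vf_deriv A ^^ n) (\<lambda>_. 0) = (\<lambda>_. 0)" for n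
    using vf_deriv_iterate_scale[of n A 0 "\<lambda>_. 0"] by simp
  have "lie_coeff A x (row_basis 0) n = (if n = 0 then 1 else 0)" for n
  proof (cases n)
    case 0
    then show ?thesis by (simp add: lie_coeff_def series_val_row_basis mpow_0)
  next
    case (Suc m)
    then have "(vf_deriv A ^^ n) (row_basis 0) = (\<lambda>_. 0)"
      by (simp only: funpow_Suc_right o_def vf_deriv_basis_0 zero)
    then show ?thesis using Suc by (simp add: lie_coeff_def series_val_def)
  qed
  then have "lie_exp A x t (row_basis 0) = (\<Sum>n. if n = 0 then 1 else 0)"
    unfolding lie_exp_def by (intro suminf_cong) auto
  also have "\<dots> = (\<Sum>n\<in>{0}. if n = (0::nat) then 1 else 0)"
    by (rule suminf_finite) auto
  finally show ?thesis by simp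
qed

lemma lie_exp_row_basis:
  "lie_exp A x t (row_basis m) = mpow (\<chi> i. lie_exp A x t (row_basis (axis i 1))) m"
proof (induction "mdeg m" arbitrary: m)
  case 0
  then have "m = 0" by (simp add: mdeg_def vec_eq_iff)
  then show ?case by (simp add: lie_exp_row_basis_0 mpow_0)
next
  case (Suc d)
  then have "m \<noteq> 0" by (auto simp: mdeg_def)
  then obtain i where "m $ i \<noteq> 0" by (auto simp: vec_eq_iff)
  then have m: "m = (m - axis i 1) + axis i 1" by (auto simp: vec_eq_iff axis_def)
  then have "d = mdeg (m - axis i 1)"
    using Suc(2) mdeg_add[of "m - axis i 1" "axis i 1"] mdeg_axis[of i] by simp
  note IH = Suc(1)[OF this]
  have "lie_exp A x t (row_basis m)
      = lie_exp A x t (row_basis (m - axis i 1)) * lie_exp A x t (row_basis (axis i 1))"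
    by (subst m) (simp only: conv_row_basis[symmetric] lie_exp_mult entire_series_row_basis)
  also have "\<dots> = mpow (\<chi> i. lie_exp A x t (row_basis (axis i 1))) ((m - axis i 1) + axis i 1)"
    by (simp only: IH mpow_add mpow_axis vec_lambda_beta)
  finally show ?case using m by simp
qed

lemma lie_exp_finite:
  assumes "finite F"
  shows "entire_series (\<lambda>k. if k \<in> F then c k else 0) \<and>
    lie_exp A x t (\<lambda>k. if k \<in> F then c k else 0) = (\<Sum>m\<in>F. c m * lie_exp A x t (row_basis m))"
  using assms
proof induction
  case empty
  have "entire_series (\<lambda>k. 0 * row_basis 0 k :: complex)"
    by (intro entire_series_scale entire_series_row_basis)
  moreover have "lie_exp A x t (\<lambda>k. 0 * row_basis 0 k) = 0"
    by (subst lie_exp_scale) (auto intro: entire_series_row_basis)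
  ultimately show ?case by simp
next
  case (insert m F)
  have eq: "(\<lambda>k. if k \<in> insert m F then c k else 0)
      = (\<lambda>k. c m * row_basis m k + (if k \<in> F then c k else 0))"
    using insert by (auto simp: row_basis_def)
  show ?case
    unfolding eq using insert
    by (simp add: entire_series_add entire_series_scale entire_series_row_basis lie_exp_add lie_exp_scale)
qed

text \<open>
  The remainder of \<open>c\<close> outside a finite set of indices is small for \<open>\<parallel>\<cdot>\<parallel>\<^sub>R\<^sub>+\<^sub>1\<close>, and \<open>L\<^sub>t\<close> is linear and bounded
  for that norm, so \<open>L\<^sub>t\<close> may be applied term by term.
\<close>

lemma has_sum_lie_exp:
  assumes c: "entire_series c"
  shows "((\<lambda>m. c m * lie_exp A x t (row_basis m)) has_sum lie_exp A x t c) UNIV"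
  unfolding has_sum_def
proof (rule tendstoI)
  fix e :: real assume e: "0 < e"
  define g where "g = (\<lambda>n. norm (c n) * (R + 1) ^ mdeg n)"
  define q where "q = 1 - norm t * rate"
  have q: "0 < q" using t by (simp add: q_def)
  have g: "g summable_on UNIV"
    unfolding g_def using entire_series_wbound_summable[OF c] R_nonneg by simp
  then have "(sum g \<longlongrightarrow> infsum g UNIV) (finite_subsets_at_top UNIV)"
    using has_sum_def has_sum_infsum by blast
  then have "\<forall>\<^sub>F F in finite_subsets_at_top UNIV. dist (sum g F) (infsum g UNIV) < e * q"
    using e q by (intro tendstoD) auto
  moreover have "\<forall>\<^sub>F F in finite_subsets_at_top UNIV. finite (F :: (nat ^ 'p) set)"
    by (rule eventually_finite_subsets_at_top_weakI)
  ultimately show "\<forall>\<^sub>F F in finite_subsets_at_top UNIV.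
      dist (\<Sum>m\<in>F. c m * lie_exp A x t (row_basis m)) (lie_exp A x t c) < e"
  proof eventually_elim
    case (elim F)
    define h where "h = (\<lambda>k. if k \<in> F then c k else 0)"
    define r where "r = (\<lambda>k. if k \<in> F then 0 else c k)"
    note h = lie_exp_finite[OF elim(2), of c, folded h_def]
    have "r = (\<lambda>k. c k + (-1) * h k)" by (auto simp: r_def h_def)
    then have r: "entire_series r" using entire_series_add[OF c entire_series_scale[of h "-1"]] h by simp
    have "wbound (R + 1) r (infsum g UNIV - sum g F)"
    proof (rule wboundI)
      fix G :: "(nat ^ 'p) set" assume G: "finite G"
      have "(\<Sum>n\<in>G. norm (r n) * (R + 1) ^ mdeg n) = (\<Sum>n\<in>G. if n \<in> F then 0 else g n)"
        by (rule sum.cong) (auto simp: r_def g_def)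
      also have "\<dots> = sum g (G - F)"
        using G by (simp add: sum.If_cases Diff_eq)
      also have "\<dots> = sum g (G \<union> F) - sum g F"
        using sum.subset_diff[of F "G \<union> F" g] G elim(2) by (simp add: Un_Diff)
      also have "sum g (G \<union> F) \<le> infsum g UNIV"
        using G elim(2) R_nonneg by (intro finite_sum_le_infsum g) (auto simp: g_def)
      finally show "(\<Sum>n\<in>G. norm (r n) * (R + 1) ^ mdeg n) \<le> infsum g UNIV - sum g F" by simp
    qed
    then have "norm (lie_exp A x t r) \<le> (infsum g UNIV - sum g F) / q"
      unfolding q_def by (rule norm_lie_exp_le[OF r])
    also have "\<dots> < e" using elim(1) q by (simp add: dist_real_def field_simps abs_less_iff)
    finally have "norm (lie_exp A x t r) < e" .
    moreover have "c = (\<lambda>k. h k + r k)" by (auto simp: h_def r_def)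
    then have "lie_exp A x t c = lie_exp A x t h + lie_exp A x t r"
      using lie_exp_add[of h r] h r by simp
    ultimately show ?case using h by (simp add: dist_norm norm_minus_commute)
  qed
qed

text \<open>
  \<open>L\<^sub>t\<close> is composition with the flow: it is determined by its values on the coordinate functions.
\<close>

lemma lie_exp_eq_series_val:
  assumes "entire_series c"
  shows "lie_exp A x t c = series_val c (\<chi> i. lie_exp A x t (row_basis (axis i 1)))"
proof -
  have "lie_exp A x t c = (\<Sum>\<^sub>\<infinity>m. c m * lie_exp A x t (row_basis m))"
    using infsumI[OF has_sum_lie_exp[OF assms]] by (rule sym)
  also have "\<dots> = series_val c (\<chi> i. lie_exp A x t (row_basis (axis i 1)))"
    unfolding series_val_def by (intro infsum_cong arg_cong[OF lie_exp_row_basis])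
  finally show ?thesis .
qed

end

text \<open>
  Differentiating the power series in \<open>t\<close> shifts its coefficients by one, which is the effect of
  \<open>D\<^sub>A\<close> on Lie coefficients.
\<close>

lemma lie_exp_has_derivative:
  assumes c: "entire_series c" and x: "\<And>i. norm (x $ i) \<le> R" and t: "norm t * rate < 1"
  shows "((\<lambda>s. lie_exp A x s c) has_field_derivative lie_exp A x t (vf_deriv A c)) (at t)"
proof -
  \<comment> \<open>A radius larger than \<open>\<bar>t\<bar>\<close> at which the series still converges; the shift by \<open>1\<close> in the
    denominator covers \<open>rate = 0\<close>.\<close>
  define s where "s = norm t + (1 - norm t * rate) / (rate + 1)"
  have "s * rate = norm t * rate + (1 - norm t * rate) * (rate / (rate + 1))"
    by (simp add: s_def algebra_simps)
  also have "\<dots> < norm t * rate + (1 - norm t * rate) * 1"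
    using t rate_nonneg by (intro add_strict_left_mono mult_strict_left_mono) auto
  finally have "s * rate < 1" by simp
  moreover have s: "norm t < s" using t rate_nonneg by (simp add: s_def)
  ultimately have "norm (complex_of_real s) * rate < 1"
    using norm_ge_zero[of t] by (simp del: norm_ge_zero)
  then have "summable (\<lambda>n. lie_coeff A x c n * complex_of_real s ^ n)"
    by (intro summable_lie_terms x c)
  from termdiffs_strong[OF this, of t] s show ?thesis
    using norm_ge_zero[of t] unfolding lie_exp_def diffs_def lie_coeff_vf_deriv by simp
qed

end

section \<open>Uniqueness of coefficients\<close>

lemma powser_zero_coeffs:
  fixes g :: "nat \<Rightarrow> complex"
  assumes "\<And>s. (\<lambda>n. g n * s ^ n) sums 0"
  shows "g n = 0"
  using assms
proof (induction n arbitrary: g)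
  case 0
  from 0[of 0] show ?case by simp
next
  case (Suc n)
  have summable: "summable (\<lambda>n. g n * s ^ n)" for s using Suc.prems sums_summable by blast
  have "(\<lambda>s. \<Sum>n. g n * s ^ n) = (\<lambda>s. 0)" using Suc.prems sums_unique by metis
  then have "(\<Sum>n. diffs g n * s ^ n) = 0" for s
    using termdiffs_strong_converges_everywhere[OF summable, of s] DERIV_unique[OF _ DERIV_const] by metis
  moreover have "summable (\<lambda>n. diffs g n * s ^ n)" for s
    by (rule termdiff_converges_all[OF summable])
  ultimately have "(\<lambda>n. diffs g n * s ^ n) sums 0" for s
    using summable_sums by metis
  then have "diffs g n = 0" by (rule Suc.IH)
  then show ?case by (simp add: diffs_def del: of_nat_Suc)
qed

text \<open>
  The variables are removed one at a time: for fixed values of the others, the series is a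
  vanishing power series in \<open>z\<^sub>i\<close>, so each of its slices \<open>n\<^sub>i = j\<close> has sum zero. After all variables have been
  treated the slice is the single index \<open>k\<close>.
\<close>

lemma series_zero_coeffs:
  fixes c :: "'p::finite row_series"
  assumes zero: "\<And>z. ((\<lambda>n. c n * mpow z n) has_sum 0) UNIV"
  shows "c k = 0"
proof -
  have "((\<lambda>n. c n * (\<Prod>l\<in>-S. (z $ l) ^ (n $ l))) has_sum 0) {n. \<forall>l\<in>S. n $ l = k $ l}"
    if "finite S" for S and z :: "complex ^ 'p"
    using that
  proof (induction S arbitrary: z)
    case empty
    then show ?case using zero[of z] by (simp add: mpow_def)
  next
    case (insert i S)
    define T where "T = {n. \<forall>l\<in>S. n $ l = k $ l}"
    define g where "g = (\<lambda>n. c n * (\<Prod>l\<in>-insert i S. (z $ l) ^ (n $ l)))"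
    define G where "G j = infsum g {n \<in> T. n $ i = j}" for j
    \<comment> \<open>The induction hypothesis with \<open>s\<close> in place of \<open>z\<^sub>i\<close>; \<open>s\<close> is the variable of the power series.\<close>
    have split: "((\<lambda>n. g n * s ^ (n $ i)) has_sum 0) T" for s
    proof -
      define w where "w = (\<chi> l. if l = i then s else z $ l)"
      have "c n * (\<Prod>l\<in>-S. (w $ l) ^ (n $ l)) = g n * s ^ (n $ i)" for n
      proof -
        have "(\<Prod>l\<in>-S. (w $ l) ^ (n $ l)) = (w $ i) ^ (n $ i) * (\<Prod>l\<in>-S - {i}. (w $ l) ^ (n $ l))"
          using insert.hyps by (intro prod.remove) auto
        also have "(\<Prod>l\<in>-S - {i}. (w $ l) ^ (n $ l)) = (\<Prod>l\<in>-insert i S. (z $ l) ^ (n $ l))"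
          by (rule prod.cong) (auto simp: w_def)
        finally show ?thesis by (simp add: w_def g_def)
      qed
      then show ?thesis using insert.IH[of w] by (simp add: T_def)
    qed
    have slice: "(g has_sum G j) {n \<in> T. n $ i = j}" for j
    proof -
      have "g summable_on T" using split[of 1] by (auto intro: has_sum_imp_summable)
      then have "g summable_on {n \<in> T. n $ i = j}" by (rule summable_on_subset_banach) auto
      then show ?thesis unfolding G_def by (rule has_sum_infsum)
    qed
    have "(\<lambda>j. G j * s ^ j) sums 0" for s
    proof (rule has_sum_imp_sums)
      have T: "T = snd ` Sigma UNIV (\<lambda>j. {n \<in> T. n $ i = j})" by force
      have "((\<lambda>q. g (snd q) * s ^ (snd q $ i)) has_sum 0) (Sigma UNIV (\<lambda>j. {n \<in> T. n $ i = j}))"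
        using split[of s] by (subst (asm) T, subst (asm) has_sum_reindex) (auto simp: inj_on_def o_def)
      then show "((\<lambda>j. G j * s ^ j) has_sum 0) UNIV"
      proof (rule has_sum_SigmaD)
        fix j
        have "((\<lambda>n. g n * s ^ j) has_sum G j * s ^ j) {n \<in> T. n $ i = j}"
          by (intro has_sum_cmult_left slice)
        then show "((\<lambda>n. g (snd (j, n)) * s ^ (snd (j, n) $ i)) has_sum G j * s ^ j) {n \<in> T. n $ i = j}"
          by (rule has_sum_cong[THEN iffD1, rotated]) auto
      qed
    qed
    then have "G (k $ i) = 0" by (rule powser_zero_coeffs)
    moreover have "{n \<in> T. n $ i = k $ i} = {n. \<forall>l\<in>insert i S. n $ l = k $ l}"
      by (auto simp: T_def)
    ultimately show ?case using slice[of "k $ i"] by (simp add: g_def)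
  qed
  from this[of UNIV] have "(c has_sum 0) {n. \<forall>l. n $ l = k $ l}" by simp
  moreover have "{n. \<forall>l. n $ l = k $ l} = {k}" by (auto simp: vec_eq_iff)
  ultimately have "(c has_sum 0) {k}" by simp
  moreover have "(c has_sum c k) {k}" by (rule has_sum_finiteI) auto
  ultimately show ?thesis by (rule has_sum_unique[symmetric])
qed

lemma has_vf_coeffs_vf_coeff:
  assumes "analytic_vf A"
  shows "has_vf_coeffs A (vf_coeff A)"
  using assms unfolding analytic_vf_def vf_coeff_def by (rule someI_ex)

lemma entire_series_vf_coeff: "has_vf_coeffs A a \<Longrightarrow> entire_series (a i)"
  unfolding has_vf_coeffs_def entire_series_def summable_on_def by blast

lemma vf_coeff_unique:
  assumes "has_vf_coeffs A a"
  shows "vf_coeff A = a"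
proof (intro ext)
  fix i k
  have "has_vf_coeffs A (vf_coeff A)"
    using assms by (intro has_vf_coeffs_vf_coeff) (auto simp: analytic_vf_def)
  then have "((\<lambda>n. vf_coeff A i n * mpow z n + - (a i n * mpow z n)) has_sum (A z $ i + - A z $ i)) UNIV" for z
    using assms unfolding has_vf_coeffs_def by (intro has_sum_add has_sum_uminusI) auto
  then have "((\<lambda>n. (vf_coeff A i n - a i n) * mpow z n) has_sum 0) UNIV" for z
    by (simp add: left_diff_distrib)
  from series_zero_coeffs[OF this] show "vf_coeff A i k = a i k" by simp
qed

section \<open>Translation of entire series\<close>

text \<open>
  This is stated over a topological ring because it serves twice: with complex entries to expand
  \<open>(x + z)\<^sup>n\<close>, and with their absolute values to majorize that expansion.
\<close>

lemma has_sum_binomial_product: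
  fixes u v :: "'p::finite \<Rightarrow> 'a::{comm_ring_1,topological_comm_monoid_add}"
  shows "((\<lambda>k. \<Prod>i\<in>UNIV. of_nat (n $ i choose (k $ i)) * u i ^ (n $ i - k $ i) * v i ^ (k $ i))
    has_sum (\<Prod>i\<in>UNIV. (u i + v i) ^ (n $ i))) UNIV"
proof (rule has_sum_finite_neutralI)
  define P where "P = PiE UNIV (\<lambda>i. {..n $ i})"
  have P: "finite P" unfolding P_def by (intro finite_PiE) auto
  have inj: "inj_on vec_lambda P" by (auto simp: inj_on_def)
  show "finite (vec_lambda ` P)" using P by simp
  have binomial: "(u i + v i) ^ m = (\<Sum>j\<in>{..m}. of_nat (m choose j) * u i ^ (m - j) * v i ^ j)" for i m
    unfolding add.commute[of "u i"] binomial_ring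
    by (rule sum.cong) (simp_all add: mult.assoc mult.commute[of "u i ^ _"])
  have "(\<Prod>i\<in>UNIV. (u i + v i) ^ (n $ i))
      = (\<Sum>g\<in>P. \<Prod>i\<in>UNIV. of_nat (n $ i choose g i) * u i ^ (n $ i - g i) * v i ^ g i)"
    unfolding binomial P_def by (rule prod_sum_PiE) auto
  also have "\<dots> = (\<Sum>k\<in>vec_lambda ` P.
      \<Prod>i\<in>UNIV. of_nat (n $ i choose (k $ i)) * u i ^ (n $ i - k $ i) * v i ^ (k $ i))"
    by (simp add: sum.reindex[OF inj])
  finally show "(\<Prod>i\<in>UNIV. (u i + v i) ^ (n $ i)) = (\<Sum>k\<in>vec_lambda ` P.
      \<Prod>i\<in>UNIV. of_nat (n $ i choose (k $ i)) * u i ^ (n $ i - k $ i) * v i ^ (k $ i))" .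
  fix k assume "k \<in> UNIV - vec_lambda ` P"
  then have "vec_nth k \<notin> P" by (metis DiffD2 image_eqI vec_nth_inverse)
  then obtain i where "n $ i < k $ i" by (auto simp: P_def PiE_def Pi_def not_le)
  then show "(\<Prod>i\<in>UNIV. of_nat (n $ i choose (k $ i)) * u i ^ (n $ i - k $ i) * v i ^ (k $ i)) = 0"
    by (intro prod_zero bexI[of _ i]) (auto simp: binomial_eq_0)
qed simp

lemma has_sum_exp_d_list_mpow:
  "((\<lambda>k. exp_d_list index_list x (row_basis n) k * mpow z k) has_sum mpow (x + z) n) UNIV"
  using has_sum_binomial_product[of n "vec_nth x" "vec_nth z"]
  by (simp add: exp_d_list_basis index_list mpow_def prod.distrib)

lemma has_sum_norm_exp_d_list:
  "((\<lambda>k. norm (exp_d_list index_list x (row_basis n) k) * s ^ mdeg k)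
    has_sum (\<Prod>i\<in>UNIV. (norm (x $ i) + s) ^ (n $ i))) UNIV"
  using has_sum_binomial_product[of n "\<lambda>i. norm (x $ i)" "\<lambda>_. s"]
  by (simp add: exp_d_list_basis index_list prod.distrib mdeg_def power_sum prod_norm[symmetric] norm_mult norm_power)

text \<open>
  Expanding each \<open>(x + z)\<^sup>n\<close> in \<open>\<Sum>\<^sub>n a\<^sub>n (x + z)\<^sup>n\<close> gives a double series; this majorant justifies
  summing it in either order. Summation over \<open>k\<close> first yields
  \<open>\<Sum>\<^sub>n \<bar>a\<^sub>n\<bar> \<Prod>\<^sub>i (\<bar>x\<^sub>i\<bar> + s)\<^bsup>n\<^sub>i\<^esup>\<close>, which is at most \<open>\<parallel>a\<parallel>\<^sub>R\<^sub>+\<^sub>s\<close>. The pairs are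
  ordered as \<open>(k, n)\<close> so that the other order of summation produces the coefficients at \<open>x\<close>.
\<close>

lemma taylor_majorant:
  fixes a :: "'p::finite row_series"
  assumes a: "entire_series a" and s: "0 \<le> s" and x: "\<And>i. norm (x $ i) \<le> R" and B: "wbound (R + s) a B"
  obtains V where "V \<le> B"
    "((\<lambda>(k, n). norm (a n * exp_d_list index_list x (row_basis n) k) * s ^ mdeg k) has_sum V) (UNIV \<times> UNIV)"
proof -
  define N where "N = (\<lambda>(n, k). norm (a n * exp_d_list index_list x (row_basis n) k) * s ^ mdeg k)"
  define W where "W n = norm (a n) * (\<Prod>i\<in>UNIV. (norm (x $ i) + s) ^ (n $ i))" for n
  have R: "0 \<le> R" using norm_ge_zero x order_trans by blast
  have W0: "0 \<le> W n" for n unfolding W_def using s by (intro mult_nonneg_nonneg prod_nonneg) auto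
  have W_le: "W n \<le> norm (a n) * (R + s) ^ mdeg n" for n
    unfolding W_def mdeg_def power_sum using s x
    by (intro mult_left_mono prod_mono conjI power_mono) auto
  have inner: "((\<lambda>k. N (n, k)) has_sum W n) UNIV" for n
    unfolding N_def W_def prod.case norm_mult mult.assoc
    by (intro has_sum_cmult_right has_sum_norm_exp_d_list)
  have N0: "0 \<le> N q" for q using s by (auto simp: N_def split: prod.split)
  have WS: "W summable_on UNIV"
    by (rule summable_on_comparison_test[OF entire_series_wbound_summable[OF a, of "R + s"]])
       (use R s W0 W_le in auto)
  have "(\<lambda>q. norm (N q)) summable_on UNIV \<times> UNIV"
    unfolding Infinite_Sum.abs_summable_on_Sigma_iff
    using inner N0 WS W0 by (simp add: infsumI[OF inner] has_sum_imp_summable[OF inner])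
  then have "N summable_on UNIV \<times> UNIV" using N0 by simp
  then have "(N has_sum infsum W UNIV) (UNIV \<times> UNIV)"
    using inner WS by (intro has_sum_SigmaI[where g = W]) auto
  then have "((\<lambda>(k, n). N (n, k)) has_sum infsum W UNIV) (UNIV \<times> UNIV)"
    by (rule iffD1[OF has_sum_swap])
  moreover have "infsum W UNIV \<le> B"
  proof (rule infsum_le_finite_sums[OF WS])
    fix F :: "(nat ^ 'p) set" assume "finite F"
    have "sum W F \<le> (\<Sum>n\<in>F. norm (a n) * (R + s) ^ mdeg n)" by (intro sum_mono W_le)
    also have "\<dots> \<le> B" using B \<open>finite F\<close> by (rule wboundD)
    finally show "sum W F \<le> B" .
  qed
  ultimately show ?thesis using that by (simp add: N_def case_prod_unfold)
qed

lemma wbound_exp_xd: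
  fixes a :: "'p::finite row_series"
  assumes a: "entire_series a" and s: "0 \<le> s" and x: "\<And>i. norm (x $ i) \<le> R" and B: "wbound (R + s) a B"
  shows "wbound s (exp_xd x a) B"
proof (rule wboundI)
  fix F :: "(nat ^ 'p) set" assume F: "finite F"
  define N where "N = (\<lambda>(k, n). norm (a n * exp_d_list index_list x (row_basis n) k) * s ^ mdeg k)"
  obtain V where V: "V \<le> B" "(N has_sum V) (UNIV \<times> UNIV)"
    unfolding N_def by (rule taylor_majorant[OF a s x B])
  have inner: "((\<lambda>n. N (k, n)) has_sum (\<Sum>\<^sub>\<infinity>n. N (k, n))) UNIV" for k
    using exp_xd_summable[OF a, of x k]
    unfolding summable_on_iff_abs_summable_on_complex N_def prod.case
    by (intro has_sum_infsum summable_on_cmult_left)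
  have outer: "((\<lambda>k. \<Sum>\<^sub>\<infinity>n. N (k, n)) has_sum V) UNIV"
    by (rule has_sum_SigmaD[OF V(2) inner])
  have N0: "0 \<le> N q" for q using s by (auto simp: N_def split: prod.split)
  have "norm (exp_xd x a k) * s ^ mdeg k \<le> (\<Sum>\<^sub>\<infinity>n. N (k, n))" for k
  proof -
    have "((\<lambda>n. a n * exp_d_list index_list x (row_basis n) k * of_real (s ^ mdeg k))
        has_sum exp_xd x a k * of_real (s ^ mdeg k)) UNIV"
      unfolding exp_xd_def by (intro has_sum_cmult_left has_sum_infsum exp_xd_summable a)
    from norm_infsum_le[OF this inner, of k] show ?thesis
      using s by (simp add: N_def norm_mult norm_power)
  qed
  then have "(\<Sum>k\<in>F. norm (exp_xd x a k) * s ^ mdeg k) \<le> (\<Sum>k\<in>F. \<Sum>\<^sub>\<infinity>n. N (k, n))"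
    by (rule sum_mono)
  also have "\<dots> \<le> V"
    using F by (intro finite_sum_le_has_sum[OF outer]) (auto intro: infsum_nonneg N0)
  finally show "(\<Sum>k\<in>F. norm (exp_xd x a k) * s ^ mdeg k) \<le> B" using V(1) by simp
qed

text \<open>
  Taylor's formula: \<open>e\<^bsup>x\<cdot>d\<^esup>\<close> is translation by \<open>x\<close>.
\<close>

lemma has_sum_exp_xd:
  fixes a :: "'p::finite row_series"
  assumes a: "entire_series a"
  shows "((\<lambda>k. exp_xd x a k * mpow z k) has_sum series_val a (x + z)) UNIV"
proof -
  define f where "f = (\<lambda>(n, k). a n * exp_d_list index_list x (row_basis n) k * mpow z k)"
  have x: "norm (x $ i) \<le> norm x" and z: "norm (z $ i) \<le> norm z" for i
    by (rule Finite_Cartesian_Product.norm_nth_le)+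
  have B: "wbound (norm x + norm z) a (\<Sum>\<^sub>\<infinity>n. norm (a n) * (norm x + norm z) ^ mdeg n)"
    using a by (intro entire_series_wbound) auto
  obtain V where "((\<lambda>(k, n). norm (a n * exp_d_list index_list x (row_basis n) k) * norm z ^ mdeg k) has_sum V) (UNIV \<times> UNIV)"
    by (rule taylor_majorant[OF a norm_ge_zero x B])
  then have "(\<lambda>q. norm (case q of (k, n) \<Rightarrow> f (n, k))) summable_on UNIV \<times> UNIV"
    by (rule Infinite_Sum.abs_summable_on_comparison_test'[OF has_sum_imp_summable])
       (auto simp: f_def norm_mult intro!: mult_left_mono norm_mpow_le z)
  then have "(\<lambda>(k, n). f (n, k)) summable_on UNIV \<times> UNIV"
    by (rule abs_summable_summable)
  then obtain S where S: "((\<lambda>(k, n). f (n, k)) has_sum S) (UNIV \<times> UNIV)"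
    unfolding summable_on_def by blast
  then have "(f has_sum S) (UNIV \<times> UNIV)" by (rule iffD2[OF has_sum_swap])
  then have "((\<lambda>n. a n * mpow (x + z) n) has_sum S) UNIV"
  proof (rule has_sum_SigmaD)
    show "((\<lambda>k. f (n, k)) has_sum a n * mpow (x + z) n) UNIV" for n
      unfolding f_def prod.case mult.assoc by (intro has_sum_cmult_right has_sum_exp_d_list_mpow)
  qed
  then have "S = series_val a (x + z)"
    unfolding series_val_def by (rule infsumI[symmetric])
  moreover have "((\<lambda>k. exp_xd x a k * mpow z k) has_sum S) UNIV"
    using S
  proof (rule has_sum_SigmaD)
    show "((\<lambda>n. case (k, n) of (k, n) \<Rightarrow> f (n, k)) has_sum exp_xd x a k * mpow z k) UNIV" for k
      unfolding f_def prod.case exp_xd_def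
      by (intro has_sum_cmult_left has_sum_infsum exp_xd_summable a)
  qed
  ultimately show ?thesis by simp
qed

lemma vf_eq_series_val:
  "has_vf_coeffs A a \<Longrightarrow> A z $ i = series_val (a i) z"
  unfolding has_vf_coeffs_def series_val_def by (metis infsumI)

lemma has_vf_coeffs_vf_shift:
  assumes "has_vf_coeffs A a"
  shows "has_vf_coeffs (vf_shift x A) (\<lambda>i. exp_xd x (a i))"
  using has_sum_exp_xd[OF entire_series_vf_coeff[OF assms]]
  by (simp add: has_vf_coeffs_def[of "\<lambda>z. A (x + z)"] vf_eq_series_val[OF assms] vf_shift_def)

context majorized_vf
begin

text \<open>
  With \<open>s = 1\<close> the translation estimate bounds the plain sum of the absolute values of the Taylor
  coefficients of \<open>A\<^sup>i\<close> at \<open>x\<close> by \<open>M i\<close>, one summand of \<open>rate / e\<close>.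
\<close>

lemma vf_norm_shift_le:
  assumes x: "\<And>i. norm (x $ i) \<le> R"
  shows "vf_norm (vf_shift x A) \<le> rate"
proof -
  note coeffs = has_vf_coeffs_vf_coeff[OF analytic]
  note shift = has_vf_coeffs_vf_shift[OF coeffs, of x]
  have M: "0 \<le> M i" for i using coeff_bound by (rule wbound_nonneg)
  have "(\<Sum>\<^sub>\<infinity>m. norm (vf_coeff (vf_shift x A) i m)) \<le> rate" for i
  proof -
    have "(\<Sum>\<^sub>\<infinity>m. norm (exp_xd x (vf_coeff A i) m) * 1 ^ mdeg m) \<le> M i"
      by (intro wbound_infsum_le wbound_exp_xd[OF _ _ x coeff_bound]
          entire_series_vf_coeff[OF shift] entire_series_vf_coeff[OF coeffs]) auto
    also have "\<dots> \<le> (\<Sum>i\<in>UNIV. M i)" using M by (intro member_le_sum) auto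
    also have "\<dots> \<le> rate"
      unfolding rate_def using mult_left_mono[of 1 "exp 1" "\<Sum>i\<in>UNIV. M i"] M by (simp add: sum_nonneg)
    finally show ?thesis by (simp add: vf_coeff_unique[OF shift])
  qed
  then show ?thesis unfolding vf_norm_def by (intro cSUP_least) auto
qed

end

section \<open>The differential equation\<close>

lemma y_term_eq: "y_term A i x n t = lie_coeff A x (row_basis (axis i 1)) n * t ^ n"
  by (simp add: y_term_def counit_exp_xd lie_coeff_def)

lemma y_fun_eq: "y_fun A i x t = lie_exp A x t (row_basis (axis i 1))"
  by (simp add: y_fun_def y_term_eq lie_exp_def)

theorem mainTheorem5:
  fixes A :: "complex ^ 'p::finite \<Rightarrow> complex ^ 'p" and Op :: "(complex ^ 'p) set"
  assumes "analytic_vf A" and "open Op" and "compact (closure Op)"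
  shows "\<exists>U::complex set. open U \<and> 0 \<in> U \<and>
    (\<forall>t\<in>U. \<forall>x\<in>Op.
       vf_norm (vf_shift x A) * norm t < 1 \<and>
       (\<forall>i. summable (\<lambda>n. y_term A i x n t) \<and>
            (y_fun A i x has_field_derivative A (\<chi> j. y_fun A j x t) $ i) (at t) \<and>
            y_fun A i x 0 = x $ i))"
proof -
  have "bounded Op" using assms(3) bounded_subset[OF compact_imp_bounded closure_subset] by blast
  then obtain R where R: "0 < R" "\<And>x. x \<in> Op \<Longrightarrow> norm x \<le> R" by (auto simp: bounded_pos)
  note coeffs = has_vf_coeffs_vf_coeff[OF assms(1)]
  define M where "M i = (\<Sum>\<^sub>\<infinity>n. norm (vf_coeff A i n) * (R + 1) ^ mdeg n)" for i
  interpret majorized_vf A R M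
    using R(1) assms(1)
    by unfold_locales (auto simp: M_def intro!: entire_series_wbound entire_series_vf_coeff[OF coeffs])
  have rate: "0 < rate + 1" using rate_nonneg by simp
  show ?thesis
    \<comment> \<open>The radius is below \<open>1 / rate\<close>, and the shift by \<open>1\<close> keeps it meaningful for \<open>rate = 0\<close>.\<close>
  proof (intro exI[of _ "ball 0 (1 / (rate + 1))"] conjI ballI allI)
    fix t :: complex and x i assume t: "t \<in> ball 0 (1 / (rate + 1))" and x: "x \<in> Op"
    have "norm t * (rate + 1) < 1" using t rate by (simp add: pos_less_divide_eq)
    then have tr: "norm t * rate < 1" using norm_ge_zero[of t] unfolding distrib_left by linarith
    have xR: "norm (x $ l) \<le> R" for l
      using R(2)[OF x] Finite_Cartesian_Product.norm_nth_le[of x l] by simp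
    have "vf_norm (vf_shift x A) * norm t \<le> rate * norm t"
      by (intro mult_right_mono vf_norm_shift_le xR) simp
    with tr show "vf_norm (vf_shift x A) * norm t < 1" by (simp add: mult.commute)
    show "summable (\<lambda>n. y_term A i x n t)"
      unfolding y_term_eq by (intro summable_lie_terms xR tr entire_series_row_basis)
    have "lie_exp A x t (vf_deriv A (row_basis (axis i 1))) = A (\<chi> j. y_fun A j x t) $ i"
      unfolding vf_deriv_basis_axis vf_eq_series_val[OF coeffs] y_fun_eq
      by (intro lie_exp_eq_series_val xR tr entire_series_vf_coeff[OF coeffs])
    then show "(y_fun A i x has_field_derivative A (\<chi> j. y_fun A j x t) $ i) (at t)"
      using lie_exp_has_derivative[OF entire_series_row_basis xR tr, of "axis i 1"]
      by (simp add: y_fun_eq[abs_def])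
    show "y_fun A i x 0 = x $ i"
      unfolding y_fun_eq lie_exp_def powser_zero
      by (simp add: lie_coeff_def series_val_row_basis mpow_axis[simplified])
  qed (use rate in auto)
qed

end
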